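(* Let $R$ be a local ring (with identity), let ${}_RM$ be a finitely generated semisimple left $R$-module and let $\varphi\in\mathrm{End}_R(M)$ be nilpotent. Let $X=\{x_{\gamma,i}\mid 1\le\gamma\le m,\ 1\le i\le k_\gamma\}$ be a nilpotent Jordan normal base of ${}_RM$ with respect to $\varphi$, with $k_1\ge k_2\ge\cdots\ge k_m\ge 1$. Then the zero-level centralizer of $\varphi$ is isomorphic, as a $Z(R)$-algebra, to the opposite of $\mathcal{N}_0(X)/\mathcal{I}(X)$: $$\mathrm{Cen}_0(\varphi)\cong\left(\mathcal{N}_0(X)/\mathcal{I}(X)\right)^{\mathrm{op}}=\mathcal{N}_0(X)^{\mathrm{op}}/\mathcal{I}(X).$$ Moreover, there is an isomorphism of $Z(R)$-algebras $$\mathrm{Cen}(\varphi)/\mathrm{Cen}_0(\varphi)\cong\left(\mathcal{N}(X)/\mathcal{N}_0(X)\right)^{\mathrm{op}}=\mathcal{N}(X)^{\mathrm{op}}/\mathcal{N}_0(X).$$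
   Context: $Z(R)$ and $J=J(R)$ are the centre and the Jacobson radical of $R$; $R$ is local if $R/J$ is a division ring. $R[z]$ is the polynomial ring in an indeterminate $z$ commuting with $R$, $(z^k)=z^kR[z]$ is the ideal generated by $z^k$ (so $(z^0)=R[z]$), and $J[z]$ is the ideal of polynomials with coefficients in $J$. $S^{\mathrm{op}}$ is the opposite ring of $S$; algebras need not have an identity. Centralizers: $\mathrm{Cen}(\varphi)=\{\psi\in\mathrm{End}_R(M)\mid\psi\circ\varphi=\varphi\circ\psi\}$ and its ideal, the zero-level centralizer $\mathrm{Cen}_0(\varphi)=\{\psi\in\mathrm{End}_R(M)\mid\psi\circ\varphi=\varphi\circ\psi=0\}$. Nilpotent Jordan normal base: a subset $X=\{x_{\gamma,i}\mid\gamma\in\Gamma,\ 1\le i\le k_\gamma\}\subseteq M$ such that each $Rx_{\gamma,i}$ is a simple submodule, $M=\bigoplus_{\gamma\in\Gamma,\,1\le i\le k_\gamma}Rx_{\gamma,i}$ (direct sum), $\varphi(x_{\gamma,i})=x_{\gamma,i+1}$ for $1\le i<k_\gamma$, $\varphi(x_{\gamma,k_\gamma})=0$, and $\{k_\gamma\}$ is bounded. Such a base exists for any nilpotent endomorphism of a semisimple module; here $M$ is finitely generated and $\Gamma=\{1,\dots,m\}$ with $m=\dim_R(\ker\varphi)$ (the number of simple summands of $\ker\varphi$). Define the following subsets of $\mathrm{M}_m(R[z])$, with $\mathbf{P}=[p_{\delta,\gamma}(z)]$: $\mathcal{I}(X)=\{\mathbf{P}\mid p_{\delta,\gamma}(z)\in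 J[z]+(z^{k_\gamma})\text{ for all }\delta,\gamma\in\Gamma\}$, $\mathcal{N}(X)=\{\mathbf{P}\mid z^{k_\delta}p_{\delta,\gamma}(z)\in J[z]+(z^{k_\gamma})\text{ for all }\delta,\gamma\in\Gamma\}$, $\mathcal{N}_0(X)=\{\mathbf{P}\mid p_{\delta,\gamma}(z)\in J[z]+(z^{k_\gamma-1})\text{ for all }\delta,\gamma\in\Gamma\}$. Here $\mathcal{N}(X)$ is a subring of $\mathrm{M}_m(R[z])$ and $\mathcal{I}(X)\subseteq\mathcal{N}_0(X)$ are ideals of $\mathcal{N}(X)$. *)

theory Defs
  imports "HOL-Algebra.QuotRing" "HOL-Algebra.UnivPoly"
begin

section \<open>Local rings\<close>

definition left_ideal :: "'a set \<Rightarrow> ('a, 'c) ring_scheme \<Rightarrow> bool" where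
  "left_ideal I R \<longleftrightarrow>
     additive_subgroup I R \<and> (\<forall>r\<in>carrier R. \<forall>a\<in>I. r \<otimes>\<^bsub>R\<^esub> a \<in> I)"

definition maximal_left_ideal :: "'a set \<Rightarrow> ('a, 'c) ring_scheme \<Rightarrow> bool" where
  "maximal_left_ideal I R \<longleftrightarrow>
     left_ideal I R \<and> I \<noteq> carrier R \<and>
     (\<forall>L. left_ideal L R \<and> I \<subseteq> L \<longrightarrow> L = I \<or> L = carrier R)"

definition jacobson_radical :: "('a, 'c) ring_scheme \<Rightarrow> 'a set" where
  "jacobson_radical R = carrier R \<inter> \<Inter> {I. maximal_left_ideal I R}"

definition skew_field :: "('a, 'c) ring_scheme \<Rightarrow> bool" where
  "skew_field D \<longleftrightarrow>
     ring D \<and> \<one>\<^bsub>D\<^esub> \<noteq> \<zero>\<^bsub>D\<^esub> \<and> Units D = carrier D - {\<zero>\<^bsub>D\<^esub>}"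

definition local_ring :: "('a, 'c) ring_scheme \<Rightarrow> bool" where
  "local_ring R \<longleftrightarrow> ring R \<and> skew_field (R Quot jacobson_radical R)"

definition ring_center :: "('a, 'c) ring_scheme \<Rightarrow> 'a set" where
  "ring_center R = {z \<in> carrier R. \<forall>r\<in>carrier R. z \<otimes>\<^bsub>R\<^esub> r = r \<otimes>\<^bsub>R\<^esub> z}"

section \<open>Left modules\<close>

text \<open>The locale \<^locale>\<open>module\<close> of the library requires a commutative ring of scalars. Its
  record type is reused here; the fields \<open>mult\<close> and \<open>one\<close> of a module are irrelevant.\<close>

locale left_module = R?: ring R + M?: abelian_group M
  for R :: "('a, 'c) ring_scheme" (structure) and M :: "('a, 'b, 'd) module_scheme" (structure) +
  assumes smult_closed:
      "\<lbrakk>a \<in> carrier R; x \<in> carrier M\<rbrakk> \<Longrightarrow> a \<odot>\<^bsub>M\<^esub> x \<in> carrier M"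
    and smult_l_distr:
      "\<lbrakk>a \<in> carrier R; b \<in> carrier R; x \<in> carrier M\<rbrakk> \<Longrightarrow>
       (a \<oplus>\<^bsub>R\<^esub> b) \<odot>\<^bsub>M\<^esub> x = a \<odot>\<^bsub>M\<^esub> x \<oplus>\<^bsub>M\<^esub> b \<odot>\<^bsub>M\<^esub> x"
    and smult_r_distr:
      "\<lbrakk>a \<in> carrier R; x \<in> carrier M; y \<in> carrier M\<rbrakk> \<Longrightarrow>
       a \<odot>\<^bsub>M\<^esub> (x \<oplus>\<^bsub>M\<^esub> y) = a \<odot>\<^bsub>M\<^esub> x \<oplus>\<^bsub>M\<^esub> a \<odot>\<^bsub>M\<^esub> y"
    and smult_assoc:
      "\<lbrakk>a \<in> carrier R; b \<in> carrier R; x \<in> carrier M\<rbrakk> \<Longrightarrow>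
       (a \<otimes>\<^bsub>R\<^esub> b) \<odot>\<^bsub>M\<^esub> x = a \<odot>\<^bsub>M\<^esub> (b \<odot>\<^bsub>M\<^esub> x)"
    and smult_one:
      "x \<in> carrier M \<Longrightarrow> \<one>\<^bsub>R\<^esub> \<odot>\<^bsub>M\<^esub> x = x"

definition fin_gen_module :: "('a, 'c) ring_scheme \<Rightarrow> ('a, 'b, 'd) module_scheme \<Rightarrow> bool" where
  "fin_gen_module R M \<longleftrightarrow>
     (\<exists>S. finite S \<and> S \<subseteq> carrier M \<and>
          (\<forall>N. submodule N R M \<and> S \<subseteq> N \<longrightarrow> N = carrier M))"

definition simple_submodule ::
    "'b set \<Rightarrow> ('a, 'c) ring_scheme \<Rightarrow> ('a, 'b, 'd) module_scheme \<Rightarrow> bool" where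
  "simple_submodule N R M \<longleftrightarrow>
     submodule N R M \<and> N \<noteq> {\<zero>\<^bsub>M\<^esub>} \<and>
     (\<forall>L. submodule L R M \<and> L \<subseteq> N \<longrightarrow> L = {\<zero>\<^bsub>M\<^esub>} \<or> L = N)"

text \<open>\<open>M\<close> is the internal direct sum of the submodules \<open>N i\<close>, \<open>i \<in> I\<close>. The sum is taken over the
  support because \<^const>\<open>finsum\<close> over an infinite set is \<open>\<zero>\<close> by convention.\<close>

definition is_direct_sum ::
    "('a, 'c) ring_scheme \<Rightarrow> ('a, 'b, 'd) module_scheme \<Rightarrow> 'i set \<Rightarrow> ('i \<Rightarrow> 'b set) \<Rightarrow> bool" where
  "is_direct_sum R M I N \<longleftrightarrow>
     (\<forall>i\<in>I. submodule (N i) R M) \<and>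
     (\<forall>y\<in>carrier M. \<exists>!f. f \<in> (\<Pi>\<^sub>E i\<in>I. N i) \<and> finite {i\<in>I. f i \<noteq> \<zero>\<^bsub>M\<^esub>} \<and>
        y = (\<Oplus>\<^bsub>M\<^esub>i\<in>{i\<in>I. f i \<noteq> \<zero>\<^bsub>M\<^esub>}. f i))"

definition semisimple_module :: "('a, 'c) ring_scheme \<Rightarrow> ('a, 'b, 'd) module_scheme \<Rightarrow> bool" where
  "semisimple_module R M \<longleftrightarrow>
     (\<exists>\<S>. (\<forall>N\<in>\<S>. simple_submodule N R M) \<and> is_direct_sum R M \<S> (\<lambda>N. N))"

definition cyclic_submodule ::
    "('a, 'c) ring_scheme \<Rightarrow> ('a, 'b, 'd) module_scheme \<Rightarrow> 'b \<Rightarrow> 'b set" where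
  "cyclic_submodule R M x = (\<lambda>r. r \<odot>\<^bsub>M\<^esub> x) ` carrier R"

section \<open>Algebras, not necessarily with an identity\<close>

text \<open>Algebras over a commutative ring are structures of the record type
  \<^typ>\<open>('r, 'x) module\<close>. Since an identity is not required, the field \<open>one\<close> is ignored throughout.
  In \<open>alg_hom K A B\<close> the set \<open>K\<close> is the carrier of the ring of scalars.\<close>

definition alg_hom ::
    "'r set \<Rightarrow> ('r, 'x, 'm) module_scheme \<Rightarrow> ('r, 'y, 'n) module_scheme \<Rightarrow> ('x \<Rightarrow> 'y) set" where
  "alg_hom K A B =
     {h \<in> carrier A \<rightarrow> carrier B.
        (\<forall>x\<in>carrier A. \<forall>y\<in>carrier A. h (x \<oplus>\<^bsub>A\<^esub> y) = h x \<oplus>\<^bsub>B\<^esub> h y) \<and>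
        (\<forall>x\<in>carrier A. \<forall>y\<in>carrier A. h (x \<otimes>\<^bsub>A\<^esub> y) = h x \<otimes>\<^bsub>B\<^esub> h y) \<and>
        (\<forall>c\<in>K. \<forall>x\<in>carrier A. h (c \<odot>\<^bsub>A\<^esub> x) = c \<odot>\<^bsub>B\<^esub> h x)}"

definition alg_isomorphic ::
    "'r set \<Rightarrow> ('r, 'x, 'm) module_scheme \<Rightarrow> ('r, 'y, 'n) module_scheme \<Rightarrow> bool" where
  "alg_isomorphic K A B \<longleftrightarrow> (\<exists>h\<in>alg_hom K A B. bij_betw h (carrier A) (carrier B))"

definition opp_alg :: "('r, 'x, 'm) module_scheme \<Rightarrow> ('r, 'x, 'm) module_scheme" where
  "opp_alg A = A\<lparr>mult := (\<lambda>x y. y \<otimes>\<^bsub>A\<^esub> x)\<rparr>"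

text \<open>The library's quotient ring \<^const>\<open>FactRing\<close> with the induced scalar multiplication
  \<open>c(a + I) = ca + I\<close>.\<close>

definition quot_alg :: "('r, 'x, 'm) module_scheme \<Rightarrow> 'x set \<Rightarrow> ('r, 'x set) module" where
  "quot_alg A I =
     \<lparr>carrier = carrier (A Quot I), mult = mult (A Quot I), one = one (A Quot I),
      zero = zero (A Quot I), add = add (A Quot I),
      smult = (\<lambda>c C. \<Union>a\<in>C. I +>\<^bsub>A\<^esub> (c \<odot>\<^bsub>A\<^esub> a))\<rparr>"

definition mat_alg :: "('r, 'x, 'm) module_scheme \<Rightarrow> 'i set \<Rightarrow> ('r, 'i \<times> 'i \<Rightarrow> 'x) module" where
  "mat_alg A I =
     \<lparr>carrier = (I \<times> I) \<rightarrow>\<^sub>E carrier A,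
      mult = (\<lambda>P Q. \<lambda>(i, j)\<in>I \<times> I. \<Oplus>\<^bsub>A\<^esub>l\<in>I. P (i, l) \<otimes>\<^bsub>A\<^esub> Q (l, j)),
      one = (\<lambda>(i, j)\<in>I \<times> I. if i = j then \<one>\<^bsub>A\<^esub> else \<zero>\<^bsub>A\<^esub>),
      zero = (\<lambda>(i, j)\<in>I \<times> I. \<zero>\<^bsub>A\<^esub>),
      add = (\<lambda>P Q. \<lambda>(i, j)\<in>I \<times> I. P (i, j) \<oplus>\<^bsub>A\<^esub> Q (i, j)),
      smult = (\<lambda>c P. \<lambda>(i, j)\<in>I \<times> I. c \<odot>\<^bsub>A\<^esub> P (i, j))\<rparr>"

section \<open>Endomorphisms and centralizers\<close>

text \<open>Endomorphisms are extensional functions on \<^term>\<open>carrier M\<close>. The scalar multiplication is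
  meaningful only for central scalars.\<close>

definition End_alg ::
    "('a, 'c) ring_scheme \<Rightarrow> ('a, 'b, 'd) module_scheme \<Rightarrow> ('a, 'b \<Rightarrow> 'b) module" where
  "End_alg R M =
     \<lparr>carrier = {f \<in> carrier M \<rightarrow>\<^sub>E carrier M.
        (\<forall>x\<in>carrier M. \<forall>y\<in>carrier M. f (x \<oplus>\<^bsub>M\<^esub> y) = f x \<oplus>\<^bsub>M\<^esub> f y) \<and>
        (\<forall>r\<in>carrier R. \<forall>x\<in>carrier M. f (r \<odot>\<^bsub>M\<^esub> x) = r \<odot>\<^bsub>M\<^esub> f x)},
      mult = compose (carrier M),
      one = (\<lambda>x\<in>carrier M. x),
      zero = (\<lambda>x\<in>carrier M. \<zero>\<^bsub>M\<^esub>),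
      add = (\<lambda>f g. \<lambda>x\<in>carrier M. f x \<oplus>\<^bsub>M\<^esub> g x),
      smult = (\<lambda>c f. \<lambda>x\<in>carrier M. c \<odot>\<^bsub>M\<^esub> f x)\<rparr>"

definition nilpotent_End ::
    "('a, 'c) ring_scheme \<Rightarrow> ('a, 'b, 'd) module_scheme \<Rightarrow> ('b \<Rightarrow> 'b) \<Rightarrow> bool" where
  "nilpotent_End R M \<phi> \<longleftrightarrow> (\<exists>n::nat. \<phi> [^]\<^bsub>End_alg R M\<^esub> n = \<zero>\<^bsub>End_alg R M\<^esub>)"

definition Cen ::
    "('a, 'c) ring_scheme \<Rightarrow> ('a, 'b, 'd) module_scheme \<Rightarrow> ('b \<Rightarrow> 'b) \<Rightarrow> ('b \<Rightarrow> 'b) set" where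
  "Cen R M \<phi> = {\<psi> \<in> carrier (End_alg R M).
     \<psi> \<otimes>\<^bsub>End_alg R M\<^esub> \<phi> = \<phi> \<otimes>\<^bsub>End_alg R M\<^esub> \<psi>}"

definition Cen0 ::
    "('a, 'c) ring_scheme \<Rightarrow> ('a, 'b, 'd) module_scheme \<Rightarrow> ('b \<Rightarrow> 'b) \<Rightarrow> ('b \<Rightarrow> 'b) set" where
  "Cen0 R M \<phi> = {\<psi> \<in> carrier (End_alg R M).
     \<psi> \<otimes>\<^bsub>End_alg R M\<^esub> \<phi> = \<phi> \<otimes>\<^bsub>End_alg R M\<^esub> \<psi> \<and>
     \<phi> \<otimes>\<^bsub>End_alg R M\<^esub> \<psi> = \<zero>\<^bsub>End_alg R M\<^esub>}"

definition Cen_alg ::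
    "('a, 'c) ring_scheme \<Rightarrow> ('a, 'b, 'd) module_scheme \<Rightarrow> ('b \<Rightarrow> 'b) \<Rightarrow> ('a, 'b \<Rightarrow> 'b) module" where
  "Cen_alg R M \<phi> = (End_alg R M)\<lparr>carrier := Cen R M \<phi>\<rparr>"

definition Cen0_alg ::
    "('a, 'c) ring_scheme \<Rightarrow> ('a, 'b, 'd) module_scheme \<Rightarrow> ('b \<Rightarrow> 'b) \<Rightarrow> ('a, 'b \<Rightarrow> 'b) module" where
  "Cen0_alg R M \<phi> = (End_alg R M)\<lparr>carrier := Cen0 R M \<phi>\<rparr>"

section \<open>Nilpotent Jordan normal bases\<close>

definition nilpotent_Jordan_base ::
    "('a, 'c) ring_scheme \<Rightarrow> ('a, 'b, 'd) module_scheme \<Rightarrow> ('b \<Rightarrow> 'b) \<Rightarrow>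
     'i set \<Rightarrow> ('i \<Rightarrow> nat) \<Rightarrow> ('i \<Rightarrow> nat \<Rightarrow> 'b) \<Rightarrow> bool" where
  "nilpotent_Jordan_base R M \<phi> \<Gamma> k x \<longleftrightarrow>
     (\<forall>\<gamma>\<in>\<Gamma>. 1 \<le> k \<gamma>) \<and>
     (\<forall>\<gamma>\<in>\<Gamma>. \<forall>i\<in>{1..k \<gamma>}. x \<gamma> i \<in> carrier M \<and>
        simple_submodule (cyclic_submodule R M (x \<gamma> i)) R M) \<and>
     is_direct_sum R M (SIGMA \<gamma>:\<Gamma>. {1..k \<gamma>}) (\<lambda>(\<gamma>, i). cyclic_submodule R M (x \<gamma> i)) \<and>
     (\<forall>\<gamma>\<in>\<Gamma>. \<forall>i\<in>{1..<k \<gamma>}. \<phi> (x \<gamma> i) = x \<gamma> (i + 1)) \<and>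
     (\<forall>\<gamma>\<in>\<Gamma>. \<phi> (x \<gamma> (k \<gamma>)) = \<zero>\<^bsub>M\<^esub>) \<and>
     (\<exists>b. \<forall>\<gamma>\<in>\<Gamma>. k \<gamma> \<le> b)"

section \<open>The matrix algebras attached to a Jordan normal base\<close>

definition radical_poly :: "('a, 'c) ring_scheme \<Rightarrow> (nat \<Rightarrow> 'a) set" where
  "radical_poly R = {p \<in> carrier (UP R). \<forall>n. coeff (UP R) p n \<in> jacobson_radical R}"

definition z_pow :: "('a, 'c) ring_scheme \<Rightarrow> nat \<Rightarrow> (nat \<Rightarrow> 'a)" where
  "z_pow R n = monom (UP R) \<one>\<^bsub>R\<^esub> n"

definition z_ideal :: "('a, 'c) ring_scheme \<Rightarrow> nat \<Rightarrow> (nat \<Rightarrow> 'a) set" where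
  "z_ideal R n = (\<lambda>q. z_pow R n \<otimes>\<^bsub>UP R\<^esub> q) ` carrier (UP R)"

definition I_set ::
    "('a, 'c) ring_scheme \<Rightarrow> 'i set \<Rightarrow> ('i \<Rightarrow> nat) \<Rightarrow> ('i \<times> 'i \<Rightarrow> nat \<Rightarrow> 'a) set" where
  "I_set R \<Gamma> k = {P \<in> carrier (mat_alg (UP R) \<Gamma>). \<forall>\<delta>\<in>\<Gamma>. \<forall>\<gamma>\<in>\<Gamma>.
     P (\<delta>, \<gamma>) \<in> radical_poly R <+>\<^bsub>UP R\<^esub> z_ideal R (k \<gamma>)}"

definition N_set ::
    "('a, 'c) ring_scheme \<Rightarrow> 'i set \<Rightarrow> ('i \<Rightarrow> nat) \<Rightarrow> ('i \<times> 'i \<Rightarrow> nat \<Rightarrow> 'a) set" where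
  "N_set R \<Gamma> k = {P \<in> carrier (mat_alg (UP R) \<Gamma>). \<forall>\<delta>\<in>\<Gamma>. \<forall>\<gamma>\<in>\<Gamma>.
     z_pow R (k \<delta>) \<otimes>\<^bsub>UP R\<^esub> P (\<delta>, \<gamma>) \<in> radical_poly R <+>\<^bsub>UP R\<^esub> z_ideal R (k \<gamma>)}"

definition N0_set ::
    "('a, 'c) ring_scheme \<Rightarrow> 'i set \<Rightarrow> ('i \<Rightarrow> nat) \<Rightarrow> ('i \<times> 'i \<Rightarrow> nat \<Rightarrow> 'a) set" where
  "N0_set R \<Gamma> k = {P \<in> carrier (mat_alg (UP R) \<Gamma>). \<forall>\<delta>\<in>\<Gamma>. \<forall>\<gamma>\<in>\<Gamma>.
     P (\<delta>, \<gamma>) \<in> radical_poly R <+>\<^bsub>UP R\<^esub> z_ideal R (k \<gamma> - 1)}"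

definition N_alg ::
    "('a, 'c) ring_scheme \<Rightarrow> 'i set \<Rightarrow> ('i \<Rightarrow> nat) \<Rightarrow> ('a, 'i \<times> 'i \<Rightarrow> nat \<Rightarrow> 'a) module" where
  "N_alg R \<Gamma> k = (mat_alg (UP R) \<Gamma>)\<lparr>carrier := N_set R \<Gamma> k\<rparr>"

definition N0_alg ::
    "('a, 'c) ring_scheme \<Rightarrow> 'i set \<Rightarrow> ('i \<Rightarrow> nat) \<Rightarrow> ('a, 'i \<times> 'i \<Rightarrow> nat \<Rightarrow> 'a) module" where
  "N0_alg R \<Gamma> k = (mat_alg (UP R) \<Gamma>)\<lparr>carrier := N0_set R \<Gamma> k\<rparr>"

end

theory Submission
  imports Defs
begin

text \<open>
  Let the polynomial ring \<open>R[z]\<close> act on \<open>M\<close> through \<open>z u = \<phi>(u)\<close>. Then the centralizer of \<open>\<phi>\<close> is the ring of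
  \<open>R[z]\<close>-endomorphisms of \<open>M\<close> (\<open>Cen_eq_End\<close>), and \<open>M\<close> is generated over \<open>R[z]\<close> by the first elements
  \<open>x \<gamma> 1\<close> of the chains of the Jordan base.

  The relations between these generators are known. As \<open>R\<close> is local, the annihilator in \<open>R\<close> of each
  base element is exactly \<open>J\<close> (\<open>annihilator_eq_jacobson_radical\<close>). Since \<open>z\<^sup>i x \<gamma> 1\<close> is the next base
  element of the chain or \<open>0\<close> after \<open>k \<gamma>\<close> steps, a row of polynomials \<open>f\<close> gives a relation if and only
  if \<open>f \<gamma>\<close> has its coefficients below \<open>k \<gamma>\<close> in \<open>J\<close>, that is, if \<open>f \<gamma> \<in> J[z] + (z\<^sup>n)\<close> for \<open>n = k \<gamma>\<close>
  (\<open>comb_eq_zero_iff_mem\<close>).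

  An endomorphism of a module with finitely many generators is given by a square matrix \<open>P\<close>, whose \<open>\<delta>\<close>-th
  row expresses the image of the \<open>\<delta>\<close>-th generator; a matrix occurs if and only if multiplying rows by
  it from the right maps relations to relations. Here this condition is \<open>P \<in> N(X)\<close>
  (\<open>N_set_iff_represents\<close>). Thus \<open>N(X)\<close> maps onto the centralizer, and composition of endomorphisms
  reverses the order of matrix products. A matrix represents \<open>0\<close> if and only if its rows are relations,
  which means \<open>P \<in> I(X)\<close>; it represents a map killed by \<open>\<phi>\<close> if and only if \<open>z\<close> times each row is a
  relation, which means \<open>P \<in> N\<^sub>0(X)\<close>. Both isomorphisms now follow from one isomorphism theorem
  (\<open>alg_isomorphic_opp_quot\<close>), applied to the surjections from \<open>N\<^sub>0(X)\<close> onto the zero-level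
  centralizer and from \<open>N(X)\<close> onto the quotient of the centralizer by it. The remaining two equations
  hold for quotients of opposite algebras in general (\<open>opp_quot_alg\<close>).
\<close>

section \<open>Structures with the same additive group, and finite sums\<close>

text \<open>A module and the polynomial module of one of its endomorphisms have the same additive group but are
  records of different types, and so have a quotient ring and the corresponding quotient algebra. The
  next three lemmas carry properties from one such structure to the other.\<close>

lemma abelian_group_cong:
  assumes "abelian_group G" "carrier H = carrier G" "zero H = zero G" "add H = add G"
  shows "abelian_group H"
proof -
  interpret abelian_group G by fact
  show ?thesis
  proof (rule abelian_groupI)
    fix x assume "x \<in> carrier H"
    then show "\<exists>y\<in>carrier H. y \<oplus>\<^bsub>H\<^esub> x = \<zero>\<^bsub>H\<^esub>"
      using l_neg[of x] assms(2-4) by (intro bexI[of _ "\<ominus>\<^bsub>G\<^esub> x"]) auto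
  qed (use assms(2-4) in \<open>auto simp: a_assoc a_comm a_lcomm\<close>)
qed

lemma ring_cong:
  assumes "ring G" "carrier H = carrier G" "zero H = zero G" "add H = add G" "mult H = mult G" "one H = one G"
  shows "ring H"
proof -
  interpret ring G by fact
  show ?thesis
  proof (rule ringI)
    show "abelian_group H" by (rule abelian_group_cong[OF is_abelian_group assms(2-4)])
    show "Group.monoid H" by (rule monoidI) (use assms(2-) in \<open>auto simp: m_assoc\<close>)
  qed (use assms(2-) in \<open>auto simp: l_distr r_distr\<close>)
qed

lemma finsum_cong_structure:
  assumes "abelian_group G" "abelian_group H"
    and eq: "carrier H = carrier G" "zero H = zero G" "add H = add G"
    and f: "f \<in> A \<rightarrow> carrier G"
  shows "finsum H f A = finsum G f A"
proof -
  interpret G: abelian_group G by fact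
  interpret H: abelian_group H by fact
  show ?thesis using f
    by (induct A rule: infinite_finite_induct) (auto simp: eq Pi_def)
qed

lemma (in abelian_group) abelian_group_restrict:
  assumes "H \<subseteq> carrier G" "\<zero> \<in> H"
    and "\<And>a b. a \<in> H \<Longrightarrow> b \<in> H \<Longrightarrow> a \<oplus> b \<in> H"
    and "\<And>a. a \<in> H \<Longrightarrow> \<exists>b\<in>H. b \<oplus> a = \<zero>"
  shows "abelian_group (G\<lparr>carrier := H\<rparr>)"
proof (rule abelian_groupI)
  fix a b c assume "a \<in> carrier (G\<lparr>carrier := H\<rparr>)" "b \<in> carrier (G\<lparr>carrier := H\<rparr>)"
    "c \<in> carrier (G\<lparr>carrier := H\<rparr>)"
  then show "a \<oplus>\<^bsub>G\<lparr>carrier := H\<rparr>\<^esub> b \<oplus>\<^bsub>G\<lparr>carrier := H\<rparr>\<^esub> c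
      = a \<oplus>\<^bsub>G\<lparr>carrier := H\<rparr>\<^esub> (b \<oplus>\<^bsub>G\<lparr>carrier := H\<rparr>\<^esub> c)"
    using assms(1) a_assoc[of a b c] by (simp add: subset_iff)
next
  fix a b assume "a \<in> carrier (G\<lparr>carrier := H\<rparr>)" "b \<in> carrier (G\<lparr>carrier := H\<rparr>)"
  then show "a \<oplus>\<^bsub>G\<lparr>carrier := H\<rparr>\<^esub> b = b \<oplus>\<^bsub>G\<lparr>carrier := H\<rparr>\<^esub> a"
    using assms(1) a_comm[of a b] by (simp add: subset_iff)
next
  fix a assume "a \<in> carrier (G\<lparr>carrier := H\<rparr>)"
  then show "\<exists>b\<in>carrier (G\<lparr>carrier := H\<rparr>). b \<oplus>\<^bsub>G\<lparr>carrier := H\<rparr>\<^esub> a = \<zero>\<^bsub>G\<lparr>carrier := H\<rparr>\<^esub>"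
    using assms(4) by simp
qed (use assms in auto)

lemma additive_imp_abelian_group_hom:
  assumes "abelian_group G" "abelian_group H" "h \<in> carrier G \<rightarrow> carrier H"
    and "\<And>x y. x \<in> carrier G \<Longrightarrow> y \<in> carrier G \<Longrightarrow> h (x \<oplus>\<^bsub>G\<^esub> y) = h x \<oplus>\<^bsub>H\<^esub> h y"
  shows "abelian_group_hom G H h"
  using assms
  by (intro abelian_group_homI group_hom.intro group_hom_axioms.intro homI abelian_group.a_group) auto

lemma (in abelian_group_hom) hom_finsum:
  "f \<in> A \<rightarrow> carrier G \<Longrightarrow> h (\<Oplus>\<^bsub>G\<^esub>i\<in>A. f i) = (\<Oplus>\<^bsub>H\<^esub>i\<in>A. h (f i))"
  by (induct A rule: infinite_finite_induct) (auto simp: Pi_def)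

lemma (in abelian_monoid) finsum_swap:
  assumes "finite A" "finite B" "\<And>i j. i \<in> A \<Longrightarrow> j \<in> B \<Longrightarrow> f i j \<in> carrier G"
  shows "(\<Oplus>i\<in>A. \<Oplus>j\<in>B. f i j) = (\<Oplus>j\<in>B. \<Oplus>i\<in>A. f i j)"
  using assms(1,3)
proof (induct A)
  case empty then show ?case by (simp add: finsum_zero)
next
  case (insert a A)
  have "(\<Oplus>j\<in>B. \<Oplus>i\<in>insert a A. f i j) = (\<Oplus>j\<in>B. f a j \<oplus> (\<Oplus>i\<in>A. f i j))"
    by (rule finsum_cong') (use insert in auto)
  with insert show ?case by (simp add: Pi_def)
qed

lemma (in abelian_monoid) finsum_Sigma:
  assumes "finite A" "\<And>i. i \<in> A \<Longrightarrow> finite (B i)"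
    and f: "\<And>i j. i \<in> A \<Longrightarrow> j \<in> B i \<Longrightarrow> f i j \<in> carrier G"
  shows "(\<Oplus>i\<in>A. \<Oplus>j\<in>B i. f i j) = finsum G (\<lambda>(i, j). f i j) (Sigma A B)"
proof -
  have "finsum G (\<lambda>(i, j). f i j) (Sigma A B) = finsum G (\<lambda>(i, j). f i j) (\<Union>i\<in>A. Pair i ` B i)"
    by (rule arg_cong[where f = "finsum G _"]) auto
  also have "\<dots> = (\<Oplus>i\<in>A. finsum G (\<lambda>(i, j). f i j) (Pair i ` B i))"
    by (rule add.finprod_UN_disjoint) (use assms in \<open>auto simp: pairwise_def disjnt_def\<close>)
  also have "\<dots> = (\<Oplus>i\<in>A. \<Oplus>j\<in>B i. f i j)"
  proof (rule finsum_cong')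
    fix i assume i: "i \<in> A"
    show "finsum G (\<lambda>(i, j). f i j) (Pair i ` B i) = (\<Oplus>j\<in>B i. f i j)"
      by (subst finsum_reindex) (use f i in \<open>auto simp: inj_on_def\<close>)
  qed (use f in auto)
  finally show ?thesis by simp
qed

section \<open>Quotients of algebras\<close>

text \<open>Both sides have the same cosets and the same sums, because passing to the opposite algebra leaves the
  additive group alone. The products agree because the product of two cosets is a union over all
  pairs of representatives, which may be formed in either order.\<close>

lemma opp_quot_alg: "opp_alg (quot_alg A I) = quot_alg (opp_alg A) I"
  by (auto simp: opp_alg_def quot_alg_def FactRing_def rcoset_mult_def A_RCOSETS_def RCOSETS_def
      a_r_coset_def r_coset_def set_add_def set_mult_def fun_eq_iff)

text \<open>The isomorphism theorem in the form in which it is used twice below. For a surjection \<open>h\<close> from \<open>A\<close> onto \<open>B\<close>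
  that reverses products, the isomorphism goes from \<open>B\<close> to the opposite of \<open>A / I\<close> and sends \<open>b\<close> to
  the fibre of \<open>h\<close> over \<open>b\<close>, which is a coset of the kernel. Algebras such as \<open>N\<^sub>0(X)\<close> may lack an
  identity; hence \<open>A\<close> is described by its additive group and by closure under the other operations.\<close>

lemma alg_isomorphic_opp_quot:
  assumes A: "abelian_group A" and B: "abelian_group B"
    and mult: "\<And>a b. a \<in> carrier A \<Longrightarrow> b \<in> carrier A \<Longrightarrow> a \<otimes>\<^bsub>A\<^esub> b \<in> carrier A"
    and smult: "\<And>c a. c \<in> K \<Longrightarrow> a \<in> carrier A \<Longrightarrow> c \<odot>\<^bsub>A\<^esub> a \<in> carrier A"
    and onto: "h ` carrier A = carrier B"
    and h_add: "\<And>a b. a \<in> carrier A \<Longrightarrow> b \<in> carrier A \<Longrightarrow> h (a \<oplus>\<^bsub>A\<^esub> b) = h a \<oplus>\<^bsub>B\<^esub> h b"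
    and h_mult: "\<And>a b. a \<in> carrier A \<Longrightarrow> b \<in> carrier A \<Longrightarrow> h (a \<otimes>\<^bsub>A\<^esub> b) = h b \<otimes>\<^bsub>B\<^esub> h a"
    and h_smult: "\<And>c a. c \<in> K \<Longrightarrow> a \<in> carrier A \<Longrightarrow> h (c \<odot>\<^bsub>A\<^esub> a) = c \<odot>\<^bsub>B\<^esub> h a"
    and I: "I = {a \<in> carrier A. h a = \<zero>\<^bsub>B\<^esub>}"
  shows "alg_isomorphic K B (opp_alg (quot_alg A I))"
proof -
  interpret A: abelian_group A by (rule A)
  interpret B: abelian_group B by (rule B)
  interpret h: abelian_group_hom A B h
    by (intro additive_imp_abelian_group_hom A B) (use onto h_add in auto)
  define fib where "fib b = {a \<in> carrier A. h a = b}" for b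
  have coset: "I +>\<^bsub>A\<^esub> a = fib (h a)" if a: "a \<in> carrier A" for a
  proof (intro equalityI subsetI)
    fix b assume b: "b \<in> fib (h a)"
    then have "b = (b \<ominus>\<^bsub>A\<^esub> a) \<oplus>\<^bsub>A\<^esub> a"
      using a by (simp add: fib_def a_minus_def A.a_assoc A.l_neg)
    moreover have "b \<ominus>\<^bsub>A\<^esub> a \<in> I"
      using a b by (simp add: fib_def I a_minus_def B.r_neg)
    ultimately show "b \<in> I +>\<^bsub>A\<^esub> a" unfolding a_r_coset_def' by blast
  qed (use a in \<open>auto simp: a_r_coset_def' fib_def I\<close>)
  have pre: "\<exists>a\<in>carrier A. h a = b" if "b \<in> carrier B" for b
  proof -
    have "b \<in> h ` carrier A" unfolding onto by fact
    then show ?thesis by blast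
  qed
  have car: "carrier (A Quot I) = fib ` carrier B"
  proof -
    have "carrier (A Quot I) = (\<lambda>a. I +>\<^bsub>A\<^esub> a) ` carrier A"
      by (auto simp: FactRing_def A_RCOSETS_def')
    also have "\<dots> = fib ` (h ` carrier A)" by (simp add: coset image_image)
    finally show ?thesis by (simp only: onto)
  qed
  have fib_add: "fib a <+>\<^bsub>A\<^esub> fib b = fib (a \<oplus>\<^bsub>B\<^esub> b)" if ab: "a \<in> carrier B" "b \<in> carrier B" for a b
  proof (intro equalityI subsetI)
    obtain u where u: "u \<in> carrier A" "h u = a" using pre ab by blast
    fix w assume w: "w \<in> fib (a \<oplus>\<^bsub>B\<^esub> b)"
    then have "w = u \<oplus>\<^bsub>A\<^esub> (\<ominus>\<^bsub>A\<^esub> u \<oplus>\<^bsub>A\<^esub> w)" "\<ominus>\<^bsub>A\<^esub> u \<oplus>\<^bsub>A\<^esub> w \<in> fib b"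
      using u ab by (simp_all add: fib_def A.r_neg2 B.r_neg1)
    then show "w \<in> fib a <+>\<^bsub>A\<^esub> fib b" using u by (auto simp: set_add_def' fib_def)
  qed (auto simp: set_add_def' fib_def)
  have fib_mult: "rcoset_mult A I (fib b) (fib a) = fib (a \<otimes>\<^bsub>B\<^esub> b)"
    if "a \<in> carrier B" "b \<in> carrier B" for a b
  proof -
    have "I +>\<^bsub>A\<^esub> (u \<otimes>\<^bsub>A\<^esub> v) = fib (a \<otimes>\<^bsub>B\<^esub> b)" if "u \<in> fib b" "v \<in> fib a" for u v
      using that coset[OF mult] h_mult by (simp add: fib_def)
    moreover have "fib b \<noteq> {}" "fib a \<noteq> {}" using pre that by (auto simp: fib_def)
    ultimately show ?thesis unfolding rcoset_mult_def by auto
  qed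
  have fib_smult: "(\<Union>a\<in>fib b. I +>\<^bsub>A\<^esub> (c \<odot>\<^bsub>A\<^esub> a)) = fib (c \<odot>\<^bsub>B\<^esub> b)"
    if "c \<in> K" "b \<in> carrier B" for b c
  proof -
    have "I +>\<^bsub>A\<^esub> (c \<odot>\<^bsub>A\<^esub> u) = fib (c \<odot>\<^bsub>B\<^esub> b)" if "u \<in> fib b" for u
      using that coset[OF smult] h_smult \<open>c \<in> K\<close> by (simp add: fib_def)
    moreover have "fib b \<noteq> {}" using pre that by (auto simp: fib_def)
    ultimately show ?thesis by auto
  qed
  have "inj_on fib (carrier B)"
  proof (rule inj_onI)
    fix a b assume "a \<in> carrier B" and eq: "fib a = fib b"
    then obtain u where "u \<in> carrier A" "h u = a" using pre by blast
    then have "u \<in> fib b" using eq by (auto simp: fib_def)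
    then show "a = b" using \<open>h u = a\<close> by (simp add: fib_def)
  qed
  then have "bij_betw fib (carrier B) (carrier (opp_alg (quot_alg A I)))"
    by (simp add: bij_betw_def opp_alg_def quot_alg_def car)
  moreover have "fib \<in> alg_hom K B (opp_alg (quot_alg A I))"
    using fib_add fib_mult fib_smult car
    by (auto simp: alg_hom_def opp_alg_def quot_alg_def FactRing_def)
  ultimately show ?thesis by (auto simp: alg_isomorphic_def)
qed

text \<open>Composing the projection \<open>B \<rightarrow> B / I\<close> with a surjection \<open>A \<rightarrow> B\<close> makes \<open>B / I\<close> an image of \<open>A\<close>, to which
  the preceding lemma applies.\<close>

lemma quot_alg_projection:
  assumes "ideal I B"
    and sm: "\<And>c b. c \<in> K \<Longrightarrow> b \<in> carrier B \<Longrightarrow> c \<odot>\<^bsub>B\<^esub> b \<in> carrier B"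
    and sm_add: "\<And>c a b. c \<in> K \<Longrightarrow> a \<in> carrier B \<Longrightarrow> b \<in> carrier B \<Longrightarrow>
          c \<odot>\<^bsub>B\<^esub> (a \<oplus>\<^bsub>B\<^esub> b) = c \<odot>\<^bsub>B\<^esub> a \<oplus>\<^bsub>B\<^esub> c \<odot>\<^bsub>B\<^esub> b"
    and sm_I: "\<And>c a. c \<in> K \<Longrightarrow> a \<in> I \<Longrightarrow> c \<odot>\<^bsub>B\<^esub> a \<in> I"
  shows "abelian_group (quot_alg B I)"
    and "(\<lambda>b. I +>\<^bsub>B\<^esub> b) \<in> alg_hom K B (quot_alg B I)"
    and "(\<lambda>b. I +>\<^bsub>B\<^esub> b) ` carrier B = carrier (quot_alg B I)"
    and "b \<in> carrier B \<Longrightarrow> I +>\<^bsub>B\<^esub> b = \<zero>\<^bsub>quot_alg B I\<^esub> \<longleftrightarrow> b \<in> I"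
proof -
  interpret ideal I B by fact
  interpret Q: ring "B Quot I" by (rule quotient_is_ring)
  show "abelian_group (quot_alg B I)"
    by (rule abelian_group_cong[OF Q.is_abelian_group]) (simp_all add: quot_alg_def)
  have coset_eq: "I +>\<^bsub>B\<^esub> a = I +>\<^bsub>B\<^esub> b" if "a \<in> I +>\<^bsub>B\<^esub> b" "b \<in> carrier B" for a b
    using that a_repr_independence' by metis
  have "(\<Union>a\<in>I +>\<^bsub>B\<^esub> b. I +>\<^bsub>B\<^esub> (c \<odot>\<^bsub>B\<^esub> a)) = I +>\<^bsub>B\<^esub> (c \<odot>\<^bsub>B\<^esub> b)"
    if cb: "c \<in> K" "b \<in> carrier B" for c b
  proof -
    have "I +>\<^bsub>B\<^esub> (c \<odot>\<^bsub>B\<^esub> a) = I +>\<^bsub>B\<^esub> (c \<odot>\<^bsub>B\<^esub> b)" if a: "a \<in> I +>\<^bsub>B\<^esub> b" for a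
    proof (rule coset_eq)
      obtain i where "i \<in> I" "a = i \<oplus>\<^bsub>B\<^esub> b" using a unfolding a_r_coset_def' by blast
      then show "c \<odot>\<^bsub>B\<^esub> a \<in> I +>\<^bsub>B\<^esub> c \<odot>\<^bsub>B\<^esub> b"
        using cb sm_add[of c i b] sm_I[of c i] by (auto simp: a_r_coset_def')
    qed (use cb sm in auto)
    then show ?thesis using a_rcos_self[OF cb(2)] by blast
  qed
  then show "(\<lambda>b. I +>\<^bsub>B\<^esub> b) \<in> alg_hom K B (quot_alg B I)"
    by (auto simp: alg_hom_def quot_alg_def FactRing_def rcoset_mult_add a_rcos_sum
        intro!: a_rcosetsI a_subset)
  show "(\<lambda>b. I +>\<^bsub>B\<^esub> b) ` carrier B = carrier (quot_alg B I)"
    by (auto simp: quot_alg_def FactRing_def A_RCOSETS_def')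
  show "I +>\<^bsub>B\<^esub> b = \<zero>\<^bsub>quot_alg B I\<^esub> \<longleftrightarrow> b \<in> I" if "b \<in> carrier B"
    using that a_rcos_self[OF that] a_coset_join2[OF that] additive_subgroup.a_subgroup is_additive_subgroup
    by (auto simp: quot_alg_def FactRing_def)
qed

section \<open>Endomorphism rings of left modules\<close>

context left_module
begin

lemma smult_hom: "a \<in> carrier R \<Longrightarrow> abelian_group_hom M M (\<lambda>x. a \<odot>\<^bsub>M\<^esub> x)"
  by (intro additive_imp_abelian_group_hom) (auto simp: smult_closed smult_r_distr M.abelian_group_axioms)

lemma scalar_hom: "x \<in> carrier M \<Longrightarrow> abelian_group_hom R M (\<lambda>a. a \<odot>\<^bsub>M\<^esub> x)"
  by (intro additive_imp_abelian_group_hom)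
    (auto simp: smult_closed smult_l_distr M.abelian_group_axioms R.is_abelian_group)

lemma smult_r_null [simp]: "a \<in> carrier R \<Longrightarrow> a \<odot>\<^bsub>M\<^esub> \<zero>\<^bsub>M\<^esub> = \<zero>\<^bsub>M\<^esub>"
  using abelian_group_hom.hom_zero[OF smult_hom] .

lemma smult_l_null [simp]: "x \<in> carrier M \<Longrightarrow> \<zero> \<odot>\<^bsub>M\<^esub> x = \<zero>\<^bsub>M\<^esub>"
  using abelian_group_hom.hom_zero[OF scalar_hom] .

lemmas smult_finsum = abelian_group_hom.hom_finsum[OF smult_hom]
lemmas finsum_smult = abelian_group_hom.hom_finsum[OF scalar_hom]

lemma End_closed: "\<psi> \<in> carrier (End_alg R M) \<Longrightarrow> x \<in> carrier M \<Longrightarrow> \<psi> x \<in> carrier M"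
  by (auto simp: End_alg_def)
lemma End_add: "\<psi> \<in> carrier (End_alg R M) \<Longrightarrow> x \<in> carrier M \<Longrightarrow> y \<in> carrier M \<Longrightarrow> 
   \<psi> (x \<oplus>\<^bsub>M\<^esub> y) = \<psi> x \<oplus>\<^bsub>M\<^esub> \<psi> y"
  by (auto simp: End_alg_def)
lemma End_smult: "\<psi> \<in> carrier (End_alg R M) \<Longrightarrow> x \<in> carrier M \<Longrightarrow> r \<in> carrier R \<Longrightarrow> 
   \<psi> (r \<odot>\<^bsub>M\<^esub> x) = r \<odot>\<^bsub>M\<^esub> \<psi> x"
  by (auto simp: End_alg_def)
lemma End_eqI: 
  "\<psi> \<in> carrier (End_alg R M) \<Longrightarrow> \<chi> \<in> carrier (End_alg R M) \<Longrightarrow> 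
   (\<And>x. x \<in> carrier M \<Longrightarrow> \<psi> x = \<chi> x) \<Longrightarrow> \<psi> = \<chi>"
  by (auto simp: End_alg_def intro: PiE_ext)

lemma End_hom: "\<psi> \<in> carrier (End_alg R M) \<Longrightarrow> abelian_group_hom M M \<psi>"
  by (intro additive_imp_abelian_group_hom) (auto simp: End_closed End_add M.abelian_group_axioms)

lemmas End_zero = abelian_group_hom.hom_zero[OF End_hom]
lemmas End_finsum = abelian_group_hom.hom_finsum[OF End_hom]

lemma End_mem_add: "\<psi> \<in> carrier (End_alg R M) \<Longrightarrow> \<chi> \<in> carrier (End_alg R M) \<Longrightarrow> 
   \<psi> \<oplus>\<^bsub>End_alg R M\<^esub> \<chi> \<in> carrier (End_alg R M)"
  by (auto simp: End_alg_def M.a_ac smult_r_distr smult_closed Pi_iff PiE_iff)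

lemma End_ring: "ring (End_alg R M)"
proof (rule ringI)
  show "abelian_group (End_alg R M)"
  proof (rule abelian_groupI)
    show "\<exists>\<chi>\<in>carrier (End_alg R M). \<chi> \<oplus>\<^bsub>End_alg R M\<^esub> \<psi> = \<zero>\<^bsub>End_alg R M\<^esub>"
      if "\<psi> \<in> carrier (End_alg R M)" for \<psi>
    proof -
      have neg: "\<ominus>\<^bsub>M\<^esub> (r \<odot>\<^bsub>M\<^esub> y) = r \<odot>\<^bsub>M\<^esub> (\<ominus>\<^bsub>M\<^esub> y)" if "r \<in> carrier R" "y \<in> carrier M" for r y
        using abelian_group_hom.hom_a_inv[OF smult_hom] that by simp
      show ?thesis
      by (rule bexI[of _ "\<lambda>x\<in>carrier M. \<ominus>\<^bsub>M\<^esub> \<psi> x"])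
        (use that in \<open>auto simp: End_alg_def M.minus_add M.l_neg M.r_neg fun_eq_iff neg smult_closed PiE_iff\<close>)
    qed
  qed (auto simp: End_mem_add End_alg_def M.a_ac fun_eq_iff PiE_iff Pi_iff extensional_def smult_closed smult_r_distr)
  show "monoid (End_alg R M)"
    by (rule monoidI) (auto simp: End_alg_def compose_def smult_closed fun_eq_iff PiE_iff extensional_def)
qed (auto simp: End_alg_def compose_def fun_eq_iff PiE_iff Pi_iff)

end

section \<open>Endomorphisms of a module with finitely many generators\<close>

lemma mat_alg_abelian_group:
  assumes "abelian_group A"
  shows "abelian_group (mat_alg A \<Gamma>)"
proof -
  interpret abelian_group A by fact
  show ?thesis
  proof (rule abelian_groupI)
    fix P assume P: "P \<in> carrier (mat_alg A \<Gamma>)"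
    let ?N = "\<lambda>(i, j)\<in>\<Gamma> \<times> \<Gamma>. \<ominus>\<^bsub>A\<^esub> P (i, j)"
    show "\<exists>Q\<in>carrier (mat_alg A \<Gamma>). Q \<oplus>\<^bsub>mat_alg A \<Gamma>\<^esub> P = \<zero>\<^bsub>mat_alg A \<Gamma>\<^esub>"
      by (rule bexI[of _ ?N]) (use P in \<open>auto simp: mat_alg_def PiE_def Pi_def l_neg fun_eq_iff\<close>)
  qed (auto simp: mat_alg_def fun_eq_iff PiE_def Pi_def extensional_def a_ac)
qed

text \<open>The ring \<open>R\<close> has the record type of an algebra because \<open>mat_alg\<close> forms matrices over an algebra; the
  case of interest is a polynomial ring.\<close>

locale finitely_generated_module = left_module R M
  for R :: "('r, 'a, 'c) module_scheme" (structure) and M :: "('a, 'b, 'd) module_scheme" (structure) +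
  fixes \<Gamma> :: "'i set" and x :: "'i \<Rightarrow> 'b"
  assumes finite_index: "finite \<Gamma>" and generators: "x \<in> \<Gamma> \<rightarrow> carrier M"
    and spanning: "y \<in> carrier M \<Longrightarrow> \<exists>f\<in>\<Gamma> \<rightarrow> carrier R. y = (\<Oplus>\<^bsub>M\<^esub>\<gamma>\<in>\<Gamma>. f \<gamma> \<odot>\<^bsub>M\<^esub> x \<gamma>)"
begin

text \<open>The combination \<open>comb\<close> is the presentation of the module as a quotient of the free module of row
  vectors. A matrix \<open>P\<close> represents \<open>\<psi>\<close> if right multiplication of rows by \<open>P\<close> covers \<open>\<psi>\<close>; it suffices to
  state this for the unit vectors, whose images under \<open>P\<close> are the rows of \<open>P\<close>.\<close>

definition comb :: "('i \<Rightarrow> 'a) \<Rightarrow> 'b" where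
  "comb f = (\<Oplus>\<^bsub>M\<^esub>\<gamma>\<in>\<Gamma>. f \<gamma> \<odot>\<^bsub>M\<^esub> x \<gamma>)"

definition represents :: "('i \<times> 'i \<Rightarrow> 'a) \<Rightarrow> ('b \<Rightarrow> 'b) \<Rightarrow> bool" where
  "represents P \<psi> \<longleftrightarrow> (\<forall>\<delta>\<in>\<Gamma>. \<psi> (x \<delta>) = comb (\<lambda>\<gamma>. P (\<delta>, \<gamma>)))"

lemma x_closed: "\<gamma> \<in> \<Gamma> \<Longrightarrow> x \<gamma> \<in> carrier M"
  using generators by auto

lemma finsum_smult_add:
  assumes "f \<in> \<Gamma> \<rightarrow> carrier R" "g \<in> \<Gamma> \<rightarrow> carrier R" "v \<in> \<Gamma> \<rightarrow> carrier M"
  shows "(\<Oplus>\<^bsub>M\<^esub>\<gamma>\<in>\<Gamma>. (f \<gamma> \<oplus> g \<gamma>) \<odot>\<^bsub>M\<^esub> v \<gamma>)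
       = (\<Oplus>\<^bsub>M\<^esub>\<gamma>\<in>\<Gamma>. f \<gamma> \<odot>\<^bsub>M\<^esub> v \<gamma>) \<oplus>\<^bsub>M\<^esub> (\<Oplus>\<^bsub>M\<^esub>\<gamma>\<in>\<Gamma>. g \<gamma> \<odot>\<^bsub>M\<^esub> v \<gamma>)"
proof -
  have "(\<Oplus>\<^bsub>M\<^esub>\<gamma>\<in>\<Gamma>. (f \<gamma> \<oplus> g \<gamma>) \<odot>\<^bsub>M\<^esub> v \<gamma>) = (\<Oplus>\<^bsub>M\<^esub>\<gamma>\<in>\<Gamma>. f \<gamma> \<odot>\<^bsub>M\<^esub> v \<gamma> \<oplus>\<^bsub>M\<^esub> g \<gamma> \<odot>\<^bsub>M\<^esub> v \<gamma>)"
    by (rule M.finsum_cong') (use assms in \<open>auto simp: Pi_iff smult_l_distr smult_closed\<close>)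
  then show ?thesis using assms by (simp add: M.finsum_addf Pi_iff smult_closed)
qed

lemma finsum_smult_scale:
  assumes "f \<in> \<Gamma> \<rightarrow> carrier R" "r \<in> carrier R" "v \<in> \<Gamma> \<rightarrow> carrier M"
  shows "(\<Oplus>\<^bsub>M\<^esub>\<gamma>\<in>\<Gamma>. (r \<otimes> f \<gamma>) \<odot>\<^bsub>M\<^esub> v \<gamma>) = r \<odot>\<^bsub>M\<^esub> (\<Oplus>\<^bsub>M\<^esub>\<gamma>\<in>\<Gamma>. f \<gamma> \<odot>\<^bsub>M\<^esub> v \<gamma>)"
proof -
  have "(\<Oplus>\<^bsub>M\<^esub>\<gamma>\<in>\<Gamma>. (r \<otimes> f \<gamma>) \<odot>\<^bsub>M\<^esub> v \<gamma>) = (\<Oplus>\<^bsub>M\<^esub>\<gamma>\<in>\<Gamma>. r \<odot>\<^bsub>M\<^esub> (f \<gamma> \<odot>\<^bsub>M\<^esub> v \<gamma>))"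
    by (rule M.finsum_cong') (use assms in \<open>auto simp: Pi_iff smult_assoc smult_closed\<close>)
  then show ?thesis using assms by (simp add: smult_finsum Pi_iff smult_closed)
qed

lemma comb_closed: "f \<in> \<Gamma> \<rightarrow> carrier R \<Longrightarrow> comb f \<in> carrier M"
  unfolding comb_def using x_closed by (auto intro!: M.finsum_closed smult_closed)

lemma comb_cong: "f \<in> \<Gamma> \<rightarrow> carrier R \<Longrightarrow> (\<And>\<gamma>. \<gamma> \<in> \<Gamma> \<Longrightarrow> g \<gamma> = f \<gamma>) \<Longrightarrow> comb g = comb f"
  unfolding comb_def using x_closed by (intro M.finsum_cong') (auto intro!: smult_closed)

lemma comb_add: "f \<in> \<Gamma> \<rightarrow> carrier R \<Longrightarrow> g \<in> \<Gamma> \<rightarrow> carrier R \<Longrightarrow>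
    comb (\<lambda>\<gamma>. f \<gamma> \<oplus> g \<gamma>) = comb f \<oplus>\<^bsub>M\<^esub> comb g"
  unfolding comb_def by (rule finsum_smult_add[OF _ _ generators])

lemma comb_smult: "f \<in> \<Gamma> \<rightarrow> carrier R \<Longrightarrow> r \<in> carrier R \<Longrightarrow>
    comb (\<lambda>\<gamma>. r \<otimes> f \<gamma>) = r \<odot>\<^bsub>M\<^esub> comb f"
  unfolding comb_def by (rule finsum_smult_scale[OF _ _ generators])

lemma comb_uminus:
  assumes f: "f \<in> \<Gamma> \<rightarrow> carrier R" shows "comb (\<lambda>\<gamma>. \<ominus> f \<gamma>) = \<ominus>\<^bsub>M\<^esub> comb f"
proof (rule M.minus_equality[symmetric])
  have "comb (\<lambda>\<gamma>. \<ominus> f \<gamma>) \<oplus>\<^bsub>M\<^esub> comb f = comb (\<lambda>\<gamma>. \<ominus> f \<gamma> \<oplus> f \<gamma>)"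
    by (rule comb_add[symmetric]) (use f in auto)
  also have "\<dots> = comb (\<lambda>\<gamma>. \<zero>)" by (rule comb_cong) (use f in \<open>auto simp: R.l_neg Pi_iff\<close>)
  also have "\<dots> = \<zero>\<^bsub>M\<^esub>" unfolding comb_def
    by (rule M.add.finprod_one_eqI) (use x_closed in simp)
  finally show "comb (\<lambda>\<gamma>. \<ominus> f \<gamma>) \<oplus>\<^bsub>M\<^esub> comb f = \<zero>\<^bsub>M\<^esub>" .
qed (use f in \<open>auto intro!: comb_closed\<close>)

lemma comb_unit:
  assumes "\<delta> \<in> \<Gamma>" shows "comb (\<lambda>\<gamma>. if \<delta> = \<gamma> then \<one> else \<zero>) = x \<delta>"
proof -
  have "comb (\<lambda>\<gamma>. if \<delta> = \<gamma> then \<one> else \<zero>) = (\<Oplus>\<^bsub>M\<^esub>\<gamma>\<in>\<Gamma>. if \<delta> = \<gamma> then x \<gamma> else \<zero>\<^bsub>M\<^esub>)"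
    unfolding comb_def by (rule M.finsum_cong') (use x_closed in \<open>auto simp: smult_one\<close>)
  then show ?thesis using M.finsum_singleton[OF assms finite_index generators] by simp
qed

lemma spanning_comb: "y \<in> carrier M \<Longrightarrow> \<exists>f\<in>\<Gamma> \<rightarrow> carrier R. y = comb f"
  using spanning by (simp add: comb_def)

lemma End_comb:
  assumes "\<psi> \<in> carrier (End_alg R M)" "f \<in> \<Gamma> \<rightarrow> carrier R"
  shows "\<psi> (comb f) = (\<Oplus>\<^bsub>M\<^esub>\<gamma>\<in>\<Gamma>. f \<gamma> \<odot>\<^bsub>M\<^esub> \<psi> (x \<gamma>))"
proof -
  have "\<psi> (comb f) = (\<Oplus>\<^bsub>M\<^esub>\<gamma>\<in>\<Gamma>. \<psi> (f \<gamma> \<odot>\<^bsub>M\<^esub> x \<gamma>))"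
    unfolding comb_def
    by (rule End_finsum[OF assms(1)]) (use assms x_closed in \<open>auto intro!: smult_closed\<close>)
  also have "\<dots> = (\<Oplus>\<^bsub>M\<^esub>\<gamma>\<in>\<Gamma>. f \<gamma> \<odot>\<^bsub>M\<^esub> \<psi> (x \<gamma>))"
    by (rule M.finsum_cong')
      (use assms x_closed in \<open>auto intro!: smult_closed simp: End_smult End_closed Pi_iff\<close>)
  finally show ?thesis .
qed

lemma End_eq_on_generators:
  assumes "\<psi> \<in> carrier (End_alg R M)" "\<chi> \<in> carrier (End_alg R M)"
    and "\<And>\<gamma>. \<gamma> \<in> \<Gamma> \<Longrightarrow> \<psi> (x \<gamma>) = \<chi> (x \<gamma>)"
  shows "\<psi> = \<chi>"
proof (rule End_eqI[OF assms(1,2)])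
  fix y assume "y \<in> carrier M"
  then obtain f where f: "f \<in> \<Gamma> \<rightarrow> carrier R" "y = comb f" using spanning_comb by blast
  show "\<psi> y = \<chi> y"
    unfolding f(2) End_comb[OF assms(1) f(1)] End_comb[OF assms(2) f(1)]
    by (rule M.finsum_cong')
      (use assms f x_closed in \<open>auto intro!: smult_closed simp: End_closed Pi_iff\<close>)
qed

text \<open>The universal property of the presentation: prescribed images of the generators extend to an
  endomorphism as soon as they satisfy every relation between the generators. The endomorphism
  sends the combination of \<open>x\<close> with coefficients \<open>f\<close> to the combination of \<open>v\<close> with the same coefficients,
  and the hypothesis on relations, applied to a difference, says that this does not depend on \<open>f\<close>.\<close>

lemma End_extension:
  assumes v: "v \<in> \<Gamma> \<rightarrow> carrier M"
    and rel: "\<And>f. f \<in> \<Gamma> \<rightarrow> carrier R \<Longrightarrow> comb f = \<zero>\<^bsub>M\<^esub> \<Longrightarrow> (\<Oplus>\<^bsub>M\<^esub>\<gamma>\<in>\<Gamma>. f \<gamma> \<odot>\<^bsub>M\<^esub> v \<gamma>) = \<zero>\<^bsub>M\<^esub>"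
  shows "\<exists>\<psi>\<in>carrier (End_alg R M). \<forall>\<gamma>\<in>\<Gamma>. \<psi> (x \<gamma>) = v \<gamma>"
proof -
  define V where "V f = (\<Oplus>\<^bsub>M\<^esub>\<gamma>\<in>\<Gamma>. f \<gamma> \<odot>\<^bsub>M\<^esub> v \<gamma>)" for f
  have V_closed: "V f \<in> carrier M" if "f \<in> \<Gamma> \<rightarrow> carrier R" for f
    unfolding V_def using that v by (auto intro!: M.finsum_closed smult_closed)
  have V_add: "V (\<lambda>\<gamma>. f \<gamma> \<oplus> g \<gamma>) = V f \<oplus>\<^bsub>M\<^esub> V g"
    if "f \<in> \<Gamma> \<rightarrow> carrier R" "g \<in> \<Gamma> \<rightarrow> carrier R" for f g
    unfolding V_def by (rule finsum_smult_add[OF that v])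
  \<comment> \<open>Two coefficient families with the same combination differ by a relation.\<close>
  have V_eq: "V f = V g" if fg: "f \<in> \<Gamma> \<rightarrow> carrier R" "g \<in> \<Gamma> \<rightarrow> carrier R" "comb f = comb g" for f g
  proof -
    have d: "(\<lambda>\<gamma>. f \<gamma> \<oplus> \<ominus> g \<gamma>) \<in> \<Gamma> \<rightarrow> carrier R" using fg by auto
    have "comb (\<lambda>\<gamma>. f \<gamma> \<oplus> \<ominus> g \<gamma>) = comb f \<oplus>\<^bsub>M\<^esub> \<ominus>\<^bsub>M\<^esub> comb g"
      using comb_add[of f "\<lambda>\<gamma>. \<ominus> g \<gamma>"] comb_uminus[of g] fg by auto
    then have "V (\<lambda>\<gamma>. f \<gamma> \<oplus> \<ominus> g \<gamma>) = \<zero>\<^bsub>M\<^esub>"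
      unfolding V_def using fg by (intro rel d) (simp add: M.r_neg comb_closed)
    then have "V (\<lambda>\<gamma>. (f \<gamma> \<oplus> \<ominus> g \<gamma>) \<oplus> g \<gamma>) = V g"
      using V_add[OF d fg(2)] V_closed[OF fg(2)] by simp
    moreover have "V (\<lambda>\<gamma>. (f \<gamma> \<oplus> \<ominus> g \<gamma>) \<oplus> g \<gamma>) = V f"
      unfolding V_def
      by (rule M.finsum_cong') (use fg v in \<open>auto simp: Pi_iff R.a_assoc R.l_neg intro!: smult_closed\<close>)
    ultimately show ?thesis by simp
  qed
  \<comment> \<open>An arbitrary choice of coefficients; by \<open>V_eq\<close> the choice is immaterial.\<close>
  define F where "F y = (SOME f. f \<in> \<Gamma> \<rightarrow> carrier R \<and> y = comb f)" for y
  have F: "F y \<in> \<Gamma> \<rightarrow> carrier R" "comb (F y) = y" if "y \<in> carrier M" for y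
  proof -
    have "\<exists>f. f \<in> \<Gamma> \<rightarrow> carrier R \<and> y = comb f" using spanning_comb[OF that] by blast
    from someI_ex[OF this] show "F y \<in> \<Gamma> \<rightarrow> carrier R" "comb (F y) = y" by (simp_all add: F_def)
  qed
  define \<psi> where "\<psi> = (\<lambda>y\<in>carrier M. V (F y))"
  have \<psi>: "\<psi> (comb f) = V f" if "f \<in> \<Gamma> \<rightarrow> carrier R" for f
    using V_eq[OF F(1) that F(2)] comb_closed[OF that] by (simp add: \<psi>_def)
  have "\<psi> \<in> carrier (End_alg R M)"
  proof -
    have "\<psi> (y \<oplus>\<^bsub>M\<^esub> z) = \<psi> y \<oplus>\<^bsub>M\<^esub> \<psi> z" if yz: "y \<in> carrier M" "z \<in> carrier M" for y z
    proof -
      have "(\<lambda>\<gamma>. F y \<gamma> \<oplus> F z \<gamma>) \<in> \<Gamma> \<rightarrow> carrier R" using F(1) yz by auto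
      from \<psi>[OF this] show ?thesis
        using comb_add[OF F(1) F(1)] V_add[OF F(1) F(1)] yz by (simp add: F \<psi>_def)
    qed
    moreover have "\<psi> (r \<odot>\<^bsub>M\<^esub> y) = r \<odot>\<^bsub>M\<^esub> \<psi> y" if ry: "r \<in> carrier R" "y \<in> carrier M" for r y
    proof -
      have "(\<lambda>\<gamma>. r \<otimes> F y \<gamma>) \<in> \<Gamma> \<rightarrow> carrier R" using F(1)[of y] ry by auto
      from \<psi>[OF this] show ?thesis
        using comb_smult[OF F(1)] finsum_smult_scale[OF F(1) _ v] ry by (simp add: F \<psi>_def V_def)
    qed
    ultimately show ?thesis
      using V_closed F(1) by (auto simp: End_alg_def \<psi>_def)
  qed
  moreover have "\<psi> (x \<gamma>) = v \<gamma>" if \<gamma>: "\<gamma> \<in> \<Gamma>" for \<gamma>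
  proof -
    have "\<psi> (x \<gamma>) = V (\<lambda>\<delta>. if \<gamma> = \<delta> then \<one> else \<zero>)"
      using \<psi>[of "\<lambda>\<delta>. if \<gamma> = \<delta> then \<one> else \<zero>"] comb_unit[OF \<gamma>] by simp
    also have "\<dots> = (\<Oplus>\<^bsub>M\<^esub>\<delta>\<in>\<Gamma>. if \<gamma> = \<delta> then v \<delta> else \<zero>\<^bsub>M\<^esub>)"
      unfolding V_def by (rule M.finsum_cong') (use v in \<open>auto simp: smult_one Pi_iff\<close>)
    finally show ?thesis using M.finsum_singleton[OF \<gamma> finite_index v] by simp
  qed
  ultimately show ?thesis by blast
qed

lemma row_closed: "P \<in> carrier (mat_alg R \<Gamma>) \<Longrightarrow> \<delta> \<in> \<Gamma> \<Longrightarrow> (\<lambda>\<gamma>. P (\<delta>, \<gamma>)) \<in> \<Gamma> \<rightarrow> carrier R"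
  by (auto simp: mat_alg_def)

lemma represents_unique:
  "\<psi> \<in> carrier (End_alg R M) \<Longrightarrow> \<chi> \<in> carrier (End_alg R M) \<Longrightarrow> represents P \<psi> \<Longrightarrow> represents P \<chi>
    \<Longrightarrow> \<psi> = \<chi>"
  by (rule End_eq_on_generators) (auto simp: represents_def)

lemma represents_exists:
  assumes "\<psi> \<in> carrier (End_alg R M)"
  shows "\<exists>P\<in>carrier (mat_alg R \<Gamma>). represents P \<psi>"
proof -
  have "\<forall>\<delta>\<in>\<Gamma>. \<exists>f\<in>\<Gamma> \<rightarrow> carrier R. \<psi> (x \<delta>) = comb f"
    using spanning_comb End_closed[OF assms] x_closed by blast
  then obtain F where F: "\<And>\<delta>. \<delta> \<in> \<Gamma> \<Longrightarrow> F \<delta> \<in> \<Gamma> \<rightarrow> carrier R" "\<And>\<delta>. \<delta> \<in> \<Gamma> \<Longrightarrow> \<psi> (x \<delta>) = comb (F \<delta>)"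
    by metis
  let ?P = "\<lambda>(\<delta>, \<gamma>)\<in>\<Gamma> \<times> \<Gamma>. F \<delta> \<gamma>"
  have "?P \<in> carrier (mat_alg R \<Gamma>)" using F(1) by (fastforce simp: mat_alg_def)
  moreover have "represents ?P \<psi>"
    unfolding represents_def
  proof
    fix \<delta> assume \<delta>: "\<delta> \<in> \<Gamma>"
    have "comb (\<lambda>\<gamma>. ?P (\<delta>, \<gamma>)) = comb (F \<delta>)" by (rule comb_cong[OF F(1)]) (use \<delta> in auto)
    then show "\<psi> (x \<delta>) = comb (\<lambda>\<gamma>. ?P (\<delta>, \<gamma>))" using F(2)[OF \<delta>] by simp
  qed
  ultimately show ?thesis by blast
qed

lemma represents_add:
  assumes "P \<in> carrier (mat_alg R \<Gamma>)" "Q \<in> carrier (mat_alg R \<Gamma>)" "represents P \<psi>" "represents Q \<chi>"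
  shows "represents (P \<oplus>\<^bsub>mat_alg R \<Gamma>\<^esub> Q) (\<psi> \<oplus>\<^bsub>End_alg R M\<^esub> \<chi>)"
  unfolding represents_def
proof
  fix \<delta> assume \<delta>: "\<delta> \<in> \<Gamma>"
  note rows = row_closed[OF assms(1) \<delta>] row_closed[OF assms(2) \<delta>]
  have "comb (\<lambda>\<gamma>. (P \<oplus>\<^bsub>mat_alg R \<Gamma>\<^esub> Q) (\<delta>, \<gamma>)) = comb (\<lambda>\<gamma>. P (\<delta>, \<gamma>) \<oplus> Q (\<delta>, \<gamma>))"
    by (rule comb_cong) (use rows \<delta> in \<open>auto simp: mat_alg_def\<close>)
  then show "(\<psi> \<oplus>\<^bsub>End_alg R M\<^esub> \<chi>) (x \<delta>) = comb (\<lambda>\<gamma>. (P \<oplus>\<^bsub>mat_alg R \<Gamma>\<^esub> Q) (\<delta>, \<gamma>))"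
    using assms(3,4) \<delta> comb_add[OF rows] by (simp add: represents_def End_alg_def x_closed)
qed

text \<open>Rows are multiplied by matrices from the right, whereas endomorphisms act from the left. This is
  where the opposite ring comes from. The proof is the interchange of two finite sums.\<close>

lemma represents_mult:
  assumes "P \<in> carrier (mat_alg R \<Gamma>)" "Q \<in> carrier (mat_alg R \<Gamma>)" "represents P \<psi>" "represents Q \<chi>"
    and \<chi>: "\<chi> \<in> carrier (End_alg R M)"
  shows "represents (P \<otimes>\<^bsub>mat_alg R \<Gamma>\<^esub> Q) (\<chi> \<otimes>\<^bsub>End_alg R M\<^esub> \<psi>)"
  unfolding represents_def
proof
  fix \<delta> assume \<delta>: "\<delta> \<in> \<Gamma>"
  note rowP = row_closed[OF assms(1) \<delta>] and rowQ = row_closed[OF assms(2)]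
  have pq: "P (\<delta>, \<epsilon>) \<in> carrier R" "Q (\<epsilon>, \<gamma>) \<in> carrier R" if "\<epsilon> \<in> \<Gamma>" "\<gamma> \<in> \<Gamma>" for \<epsilon> \<gamma>
    using rowP rowQ that by auto
  have "(\<chi> \<otimes>\<^bsub>End_alg R M\<^esub> \<psi>) (x \<delta>) = \<chi> (comb (\<lambda>\<epsilon>. P (\<delta>, \<epsilon>)))"
    using assms(3) \<delta> by (simp add: represents_def End_alg_def compose_def x_closed)
  also have "\<dots> = (\<Oplus>\<^bsub>M\<^esub>\<epsilon>\<in>\<Gamma>. P (\<delta>, \<epsilon>) \<odot>\<^bsub>M\<^esub> \<chi> (x \<epsilon>))"
    by (rule End_comb[OF \<chi> rowP])
  also have "\<dots> = (\<Oplus>\<^bsub>M\<^esub>\<epsilon>\<in>\<Gamma>. \<Oplus>\<^bsub>M\<^esub>\<gamma>\<in>\<Gamma>. (P (\<delta>, \<epsilon>) \<otimes> Q (\<epsilon>, \<gamma>)) \<odot>\<^bsub>M\<^esub> x \<gamma>)"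
  proof (rule M.finsum_cong')
    fix \<epsilon> assume \<epsilon>: "\<epsilon> \<in> \<Gamma>"
    show "P (\<delta>, \<epsilon>) \<odot>\<^bsub>M\<^esub> \<chi> (x \<epsilon>) = (\<Oplus>\<^bsub>M\<^esub>\<gamma>\<in>\<Gamma>. (P (\<delta>, \<epsilon>) \<otimes> Q (\<epsilon>, \<gamma>)) \<odot>\<^bsub>M\<^esub> x \<gamma>)"
      using assms(4) \<epsilon> comb_smult[OF rowQ[OF \<epsilon>] pq(1)[OF \<epsilon> \<epsilon>]]
      by (simp add: represents_def comb_def)
  qed (use pq x_closed in \<open>auto intro!: smult_closed M.finsum_closed\<close>)
  also have "\<dots> = (\<Oplus>\<^bsub>M\<^esub>\<gamma>\<in>\<Gamma>. \<Oplus>\<^bsub>M\<^esub>\<epsilon>\<in>\<Gamma>. (P (\<delta>, \<epsilon>) \<otimes> Q (\<epsilon>, \<gamma>)) \<odot>\<^bsub>M\<^esub> x \<gamma>)"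
    by (rule M.finsum_swap) (use finite_index pq x_closed in \<open>auto intro!: smult_closed\<close>)
  also have "\<dots> = comb (\<lambda>\<gamma>. (P \<otimes>\<^bsub>mat_alg R \<Gamma>\<^esub> Q) (\<delta>, \<gamma>))"
    unfolding comb_def
  proof (rule M.finsum_cong')
    fix \<gamma> assume \<gamma>: "\<gamma> \<in> \<Gamma>"
    show "(\<Oplus>\<^bsub>M\<^esub>\<epsilon>\<in>\<Gamma>. (P (\<delta>, \<epsilon>) \<otimes> Q (\<epsilon>, \<gamma>)) \<odot>\<^bsub>M\<^esub> x \<gamma>) = (P \<otimes>\<^bsub>mat_alg R \<Gamma>\<^esub> Q) (\<delta>, \<gamma>) \<odot>\<^bsub>M\<^esub> x \<gamma>"
      using finsum_smult[OF x_closed[OF \<gamma>], of "\<lambda>\<epsilon>. P (\<delta>, \<epsilon>) \<otimes> Q (\<epsilon>, \<gamma>)" \<Gamma>] pq \<gamma> \<delta>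
      by (simp add: mat_alg_def Pi_iff)
  qed (use pq x_closed \<delta> in \<open>auto simp: mat_alg_def intro!: smult_closed R.finsum_closed\<close>)
  finally show "(\<chi> \<otimes>\<^bsub>End_alg R M\<^esub> \<psi>) (x \<delta>) = comb (\<lambda>\<gamma>. (P \<otimes>\<^bsub>mat_alg R \<Gamma>\<^esub> Q) (\<delta>, \<gamma>))" .
qed

end

section \<open>The polynomial module of an endomorphism\<close>

text \<open>The endomorphism \<open>\<phi>\<close> makes \<open>M\<close> a left module over the polynomial ring in which the indeterminate
  acts as \<open>\<phi>\<close>. The sum stops at the degree because \<open>finsum\<close> over an infinite set is \<open>0\<close>.\<close>

definition poly_module ::
    "('a, 'c) ring_scheme \<Rightarrow> ('a, 'b, 'd) module_scheme \<Rightarrow> ('b \<Rightarrow> 'b) \<Rightarrow> (nat \<Rightarrow> 'a, 'b) module" where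
  "poly_module R M \<phi> =
     \<lparr>carrier = carrier M, mult = mult M, one = one M, zero = zero M, add = add M,
      smult = (\<lambda>p u. \<Oplus>\<^bsub>M\<^esub>i\<in>{..deg R p}. coeff (UP R) p i \<odot>\<^bsub>M\<^esub> (\<phi> ^^ i) u)\<rparr>"

lemma poly_module_simps [simp]:
  "carrier (poly_module R M \<phi>) = carrier M" "zero (poly_module R M \<phi>) = zero M"
  "add (poly_module R M \<phi>) = add M"
  by (simp_all add: poly_module_def)

lemma (in UP_ring) coeff_monom_mult:
  assumes "a \<in> carrier R" "q \<in> carrier P"
  shows "coeff P (monom P a n \<otimes>\<^bsub>P\<^esub> q) k = (if n \<le> k then a \<otimes> coeff P q (k - n) else \<zero>)"
proof -
  have "coeff P (monom P a n \<otimes>\<^bsub>P\<^esub> q) k = (\<Oplus>i\<in>{..k}. if n = i then a \<otimes> coeff P q (k - i) else \<zero>)"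
    unfolding coeff_mult[OF monom_closed[OF assms(1)] assms(2)]
    by (rule R.finsum_cong') (use assms in auto)
  also have "\<dots> = (if n \<le> k then a \<otimes> coeff P q (k - n) else \<zero>)"
  proof (cases "n \<le> k")
    case True
    then show ?thesis
      using R.finsum_singleton[of n "{..k}" "\<lambda>i. a \<otimes> coeff P q (k - i)"] assms by simp
  next
    case False
    then show ?thesis by (auto intro!: R.add.finprod_one_eqI)
  qed
  finally show ?thesis .
qed

locale module_endomorphism = left_module R M
  for R :: "('a, 'c) ring_scheme" (structure) and M :: "('a, 'b, 'd) module_scheme" (structure) +
  fixes \<phi> :: "'b \<Rightarrow> 'b"
  assumes phi_End: "\<phi> \<in> carrier (End_alg R M)"
begin

sublocale UP: UP_ring R "UP R"
  by unfold_locales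

abbreviation act :: "(nat \<Rightarrow> 'a) \<Rightarrow> 'b \<Rightarrow> 'b" where
  "act p u \<equiv> p \<odot>\<^bsub>poly_module R M \<phi>\<^esub> u"

abbreviation z :: "nat \<Rightarrow> 'a" where "z \<equiv> monom (UP R) \<one> (Suc 0)"

lemma phi_pow_closed: "u \<in> carrier M \<Longrightarrow> (\<phi> ^^ i) u \<in> carrier M"
  by (induct i) (auto intro: End_closed[OF phi_End])

lemma phi_pow_add: "u \<in> carrier M \<Longrightarrow> v \<in> carrier M \<Longrightarrow>
    (\<phi> ^^ i) (u \<oplus>\<^bsub>M\<^esub> v) = (\<phi> ^^ i) u \<oplus>\<^bsub>M\<^esub> (\<phi> ^^ i) v"
  by (induct i) (auto simp: End_add[OF phi_End] phi_pow_closed)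

text \<open>Summing beyond the degree changes nothing; this allows a common range of summation for several
  polynomials.\<close>

lemma act_eq:
  assumes "p \<in> carrier (UP R)" "deg R p \<le> n" "u \<in> carrier M"
  shows "act p u = (\<Oplus>\<^bsub>M\<^esub>i\<in>{..n}. coeff (UP R) p i \<odot>\<^bsub>M\<^esub> (\<phi> ^^ i) u)"
  unfolding poly_module_def module.simps
  by (rule M.add.finprod_mono_neutral_cong_left)
    (use assms UP.deg_aboveD[OF _ assms(1)] in \<open>auto simp: phi_pow_closed smult_closed\<close>)

lemma act_closed: "p \<in> carrier (UP R) \<Longrightarrow> u \<in> carrier M \<Longrightarrow> act p u \<in> carrier M"
  by (auto simp: act_eq[OF _ order.refl] intro!: M.finsum_closed smult_closed phi_pow_closed)

lemma act_add_left:
  assumes "p \<in> carrier (UP R)" "q \<in> carrier (UP R)" "u \<in> carrier M"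
  shows "act (p \<oplus>\<^bsub>UP R\<^esub> q) u = act p u \<oplus>\<^bsub>M\<^esub> act q u"
proof -
  let ?n = "max (deg R p) (deg R q)"
  have "act (p \<oplus>\<^bsub>UP R\<^esub> q) u = (\<Oplus>\<^bsub>M\<^esub>i\<in>{..?n}. coeff (UP R) p i \<odot>\<^bsub>M\<^esub> (\<phi> ^^ i) u \<oplus>\<^bsub>M\<^esub> coeff (UP R) q i \<odot>\<^bsub>M\<^esub> (\<phi> ^^ i) u)"
    unfolding act_eq[OF UP.UP_a_closed[OF assms(1,2)] UP.deg_add[OF assms(1,2)] assms(3)]
    by (rule M.finsum_cong')
      (use assms in \<open>auto simp: smult_l_distr phi_pow_closed intro!: smult_closed\<close>)
  also have "\<dots> = act p u \<oplus>\<^bsub>M\<^esub> act q u"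
    using assms by (subst M.finsum_addf)
      (auto simp: act_eq[of p ?n] act_eq[of q ?n] phi_pow_closed intro!: smult_closed)
  finally show ?thesis .
qed

lemma act_add_right:
  assumes "p \<in> carrier (UP R)" "u \<in> carrier M" "v \<in> carrier M"
  shows "act p (u \<oplus>\<^bsub>M\<^esub> v) = act p u \<oplus>\<^bsub>M\<^esub> act p v"
proof -
  have "act p (u \<oplus>\<^bsub>M\<^esub> v) = (\<Oplus>\<^bsub>M\<^esub>i\<in>{..deg R p}. coeff (UP R) p i \<odot>\<^bsub>M\<^esub> (\<phi> ^^ i) u \<oplus>\<^bsub>M\<^esub> coeff (UP R) p i \<odot>\<^bsub>M\<^esub> (\<phi> ^^ i) v)"
    unfolding act_eq[OF assms(1) order.refl M.add.m_closed[OF assms(2,3)]]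
    by (rule M.finsum_cong')
      (use assms in \<open>auto simp: smult_r_distr phi_pow_add phi_pow_closed intro!: smult_closed\<close>)
  also have "\<dots> = act p u \<oplus>\<^bsub>M\<^esub> act p v"
    using assms by (subst M.finsum_addf)
      (auto simp: act_eq[OF assms(1) order.refl] phi_pow_closed intro!: smult_closed)
  finally show ?thesis .
qed

lemma act_one: "u \<in> carrier M \<Longrightarrow> act \<one>\<^bsub>UP R\<^esub> u = u"
  by (simp add: act_eq[of _ 0] smult_one)

lemma act_smult:
  assumes "a \<in> carrier R" "p \<in> carrier (UP R)" "u \<in> carrier M"
  shows "act (a \<odot>\<^bsub>UP R\<^esub> p) u = a \<odot>\<^bsub>M\<^esub> act p u"
proof -
  have d: "deg R (a \<odot>\<^bsub>UP R\<^esub> p) \<le> deg R p"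
    by (rule UP.deg_aboveI) (use assms UP.deg_aboveD in auto)
  have "act (a \<odot>\<^bsub>UP R\<^esub> p) u = (\<Oplus>\<^bsub>M\<^esub>i\<in>{..deg R p}. a \<odot>\<^bsub>M\<^esub> (coeff (UP R) p i \<odot>\<^bsub>M\<^esub> (\<phi> ^^ i) u))"
    unfolding act_eq[OF UP.UP_smult_closed[OF assms(1,2)] d assms(3)]
    by (rule M.finsum_cong') (use assms in \<open>auto simp: smult_assoc phi_pow_closed intro!: smult_closed\<close>)
  also have "\<dots> = a \<odot>\<^bsub>M\<^esub> act p u"
    unfolding act_eq[OF assms(2) order.refl assms(3)]
    by (rule smult_finsum[OF assms(1), symmetric])
      (use assms in \<open>auto simp: phi_pow_closed intro!: smult_closed\<close>)
  finally show ?thesis .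
qed

lemma act_z_mult:
  assumes q: "q \<in> carrier (UP R)" and u: "u \<in> carrier M"
  shows "act (z \<otimes>\<^bsub>UP R\<^esub> q) u = \<phi> (act q u)"
proof -
  let ?f = "\<lambda>i. coeff (UP R) (z \<otimes>\<^bsub>UP R\<^esub> q) i \<odot>\<^bsub>M\<^esub> (\<phi> ^^ i) u"
  have zq: "z \<otimes>\<^bsub>UP R\<^esub> q \<in> carrier (UP R)" using q by simp
  have c: "coeff (UP R) (z \<otimes>\<^bsub>UP R\<^esub> q) k = (if 1 \<le> k then coeff (UP R) q (k - 1) else \<zero>)" for k
    using UP.coeff_monom_mult[OF R.one_closed q, of "Suc 0" k] q by simp
  have d: "deg R (z \<otimes>\<^bsub>UP R\<^esub> q) \<le> Suc (deg R q)"
    by (rule UP.deg_aboveI[OF _ zq], unfold c) (use UP.deg_aboveD[OF _ q] in auto)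
  have f: "?f i \<in> carrier M" for i using zq u by (simp add: phi_pow_closed smult_closed)
  have "act (z \<otimes>\<^bsub>UP R\<^esub> q) u = (\<Oplus>\<^bsub>M\<^esub>i\<in>{..deg R q}. ?f (Suc i)) \<oplus>\<^bsub>M\<^esub> ?f 0"
    unfolding act_eq[OF zq d u] by (rule M.finsum_Suc2) (use f in auto)
  also have "?f 0 = \<zero>\<^bsub>M\<^esub>" using u by (simp add: c)
  also have "(\<Oplus>\<^bsub>M\<^esub>i\<in>{..deg R q}. ?f (Suc i)) = (\<Oplus>\<^bsub>M\<^esub>i\<in>{..deg R q}. \<phi> (coeff (UP R) q i \<odot>\<^bsub>M\<^esub> (\<phi> ^^ i) u))"
    by (rule M.finsum_cong')
      (use q u in \<open>auto simp: c End_smult[OF phi_End] phi_pow_closed intro!: smult_closed End_closed[OF phi_End]\<close>)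
  also have "\<dots> = \<phi> (act q u)"
    unfolding act_eq[OF q order.refl u]
    by (rule End_finsum[OF phi_End, symmetric]) (use q u in \<open>auto simp: phi_pow_closed intro!: smult_closed\<close>)
  also have "\<phi> (act q u) \<oplus>\<^bsub>M\<^esub> \<zero>\<^bsub>M\<^esub> = \<phi> (act q u)"
    using End_closed[OF phi_End act_closed[OF q u]] by simp
  finally show ?thesis .
qed

lemma act_monom_mult:
  assumes "a \<in> carrier R" "q \<in> carrier (UP R)" "u \<in> carrier M"
  shows "act (monom (UP R) a n \<otimes>\<^bsub>UP R\<^esub> q) u = a \<odot>\<^bsub>M\<^esub> (\<phi> ^^ n) (act q u)"
  using assms(2)
proof (induct n arbitrary: q)
  case 0
  then show ?case using assms by (simp add: UP.monom_mult_is_smult act_smult)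
next
  case (Suc n)
  have "monom (UP R) a (Suc n) = monom (UP R) a n \<otimes>\<^bsub>UP R\<^esub> z"
    using UP.monom_mult[OF assms(1) R.one_closed, of n 1] assms(1) by simp
  then have "monom (UP R) a (Suc n) \<otimes>\<^bsub>UP R\<^esub> q = monom (UP R) a n \<otimes>\<^bsub>UP R\<^esub> (z \<otimes>\<^bsub>UP R\<^esub> q)"
    using assms(1) Suc.prems by (simp add: UP.UP_m_assoc)
  then show ?case
    using Suc.hyps[of "z \<otimes>\<^bsub>UP R\<^esub> q"] Suc.prems assms(3)
    by (simp add: act_z_mult funpow_Suc_right del: funpow.simps(2))
qed

lemma act_monom:
  assumes "a \<in> carrier R" "u \<in> carrier M"
  shows "act (monom (UP R) a n) u = a \<odot>\<^bsub>M\<^esub> (\<phi> ^^ n) u"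
  using act_monom_mult[OF assms(1) UP.UP_one_closed assms(2), of n] assms
  by (simp add: act_one)

text \<open>Both sides are additive in \<open>p\<close>, so that monomials suffice, and for these the claim follows from the
  action of the indeterminate, which shifts coefficients.\<close>

lemma act_assoc:
  assumes p: "p \<in> carrier (UP R)" and q: "q \<in> carrier (UP R)" and u: "u \<in> carrier M"
  shows "act (p \<otimes>\<^bsub>UP R\<^esub> q) u = act p (act q u)"
proof -
  let ?m = "\<lambda>i. monom (UP R) (coeff (UP R) p i) i"
  have hom1: "abelian_group_hom (UP R) M (\<lambda>p. act (p \<otimes>\<^bsub>UP R\<^esub> q) u)"
    by (rule additive_imp_abelian_group_hom)
      (use q u in \<open>auto simp: UP.abelian_group_axioms M.abelian_group_axioms act_closed act_add_left UP.l_distr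
        intro: UP.is_abelian_group\<close>)
  have hom2: "abelian_group_hom (UP R) M (\<lambda>p. act p (act q u))"
    by (rule additive_imp_abelian_group_hom)
      (use q u in \<open>auto simp: M.abelian_group_axioms act_closed act_add_left intro: UP.is_abelian_group\<close>)
  have m: "?m \<in> {..deg R p} \<rightarrow> carrier (UP R)" using p by simp
  have "act (p \<otimes>\<^bsub>UP R\<^esub> q) u = act ((\<Oplus>\<^bsub>UP R\<^esub>i\<in>{..deg R p}. ?m i) \<otimes>\<^bsub>UP R\<^esub> q) u"
    using UP.up_repr[OF p] by simp
  also have "\<dots> = (\<Oplus>\<^bsub>M\<^esub>i\<in>{..deg R p}. act (?m i \<otimes>\<^bsub>UP R\<^esub> q) u)"
    by (rule abelian_group_hom.hom_finsum[OF hom1 m])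
  also have "\<dots> = (\<Oplus>\<^bsub>M\<^esub>i\<in>{..deg R p}. act (?m i) (act q u))"
    by (rule M.finsum_cong')
      (use p q u in \<open>auto simp: act_monom_mult act_monom act_closed phi_pow_closed intro!: smult_closed\<close>)
  also have "\<dots> = act (\<Oplus>\<^bsub>UP R\<^esub>i\<in>{..deg R p}. ?m i) (act q u)"
    by (rule abelian_group_hom.hom_finsum[OF hom2 m, symmetric])
  finally show ?thesis using UP.up_repr[OF p] by simp
qed

lemma poly_module_abelian_group: "abelian_group (poly_module R M \<phi>)"
  by (rule abelian_group_cong[OF M.abelian_group_axioms]) simp_all

lemma poly_module_left_module: "left_module (UP R) (poly_module R M \<phi>)"
  by (intro left_module.intro left_module_axioms.intro UP.UP_ring poly_module_abelian_group)
    (simp_all add: act_closed act_add_left act_add_right act_assoc act_one)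

lemma Cen_phi:
  assumes "\<psi> \<in> Cen R M \<phi>" "u \<in> carrier M" shows "\<psi> (\<phi> u) = \<phi> (\<psi> u)"
proof -
  have "compose (carrier M) \<psi> \<phi> = compose (carrier M) \<phi> \<psi>"
    using assms(1) by (simp add: Cen_def End_alg_def)
  from fun_cong[OF this, of u] show ?thesis using assms(2) by (simp add: compose_def)
qed

lemma Cen_phi_pow:
  "\<psi> \<in> Cen R M \<phi> \<Longrightarrow> u \<in> carrier M \<Longrightarrow> \<psi> ((\<phi> ^^ i) u) = (\<phi> ^^ i) (\<psi> u)"
  by (induct i) (simp_all add: Cen_phi phi_pow_closed)

text \<open>An additive map that commutes with the scalars and with \<open>\<phi>\<close> commutes with every polynomial in \<open>\<phi>\<close>.
  This turns the problem into one about endomorphisms of a module with known generators and relations.\<close>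

lemma Cen_eq_End: "Cen R M \<phi> = carrier (End_alg (UP R) (poly_module R M \<phi>))"
proof (intro equalityI subsetI)
  fix \<psi> assume C: "\<psi> \<in> Cen R M \<phi>"
  then have \<psi>: "\<psi> \<in> carrier (End_alg R M)" by (simp add: Cen_def)
  have "\<psi> (act p u) = act p (\<psi> u)" if p: "p \<in> carrier (UP R)" and u: "u \<in> carrier M" for p u
  proof -
    have "\<psi> (act p u) = (\<Oplus>\<^bsub>M\<^esub>i\<in>{..deg R p}. \<psi> (coeff (UP R) p i \<odot>\<^bsub>M\<^esub> (\<phi> ^^ i) u))"
      unfolding act_eq[OF p order.refl u]
      by (rule End_finsum[OF \<psi>]) (use p u in \<open>auto simp: phi_pow_closed intro!: smult_closed\<close>)
    also have "\<dots> = act p (\<psi> u)"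
      unfolding act_eq[OF p order.refl End_closed[OF \<psi> u]]
      by (rule M.finsum_cong')
        (use p u in \<open>auto simp: End_smult[OF \<psi>] Cen_phi_pow[OF C] phi_pow_closed End_closed[OF \<psi>] intro!: smult_closed\<close>)
    finally show ?thesis .
  qed
  then show "\<psi> \<in> carrier (End_alg (UP R) (poly_module R M \<phi>))"
    using \<psi> by (simp add: End_alg_def)
next
  fix \<psi> assume "\<psi> \<in> carrier (End_alg (UP R) (poly_module R M \<phi>))"
  then have \<psi>: "\<psi> \<in> carrier M \<rightarrow>\<^sub>E carrier M"
    "\<And>u v. u \<in> carrier M \<Longrightarrow> v \<in> carrier M \<Longrightarrow> \<psi> (u \<oplus>\<^bsub>M\<^esub> v) = \<psi> u \<oplus>\<^bsub>M\<^esub> \<psi> v"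
    "\<And>p u. p \<in> carrier (UP R) \<Longrightarrow> u \<in> carrier M \<Longrightarrow> \<psi> (act p u) = act p (\<psi> u)"
    by (auto simp: End_alg_def)
  have cl: "\<psi> u \<in> carrier M" if "u \<in> carrier M" for u using \<psi>(1) that by auto
  have "\<psi> (r \<odot>\<^bsub>M\<^esub> u) = r \<odot>\<^bsub>M\<^esub> \<psi> u" if "r \<in> carrier R" "u \<in> carrier M" for r u
    using \<psi>(3)[of "monom (UP R) r 0" u] that cl by (simp add: act_monom)
  then have "\<psi> \<in> carrier (End_alg R M)" using \<psi> by (simp add: End_alg_def)
  moreover have "\<psi> (\<phi> u) = \<phi> (\<psi> u)" if "u \<in> carrier M" for u
    using \<psi>(3)[of z u] that cl End_closed[OF phi_End] by (simp add: act_monom smult_one)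
  then have "compose (carrier M) \<psi> \<phi> = compose (carrier M) \<phi> \<psi>"
    by (auto simp: compose_def fun_eq_iff)
  ultimately show "\<psi> \<in> Cen R M \<phi>" by (simp add: Cen_def End_alg_def)
qed

lemma phi_mem_Cen: "\<phi> \<in> Cen R M \<phi>"
  using phi_End by (simp add: Cen_def)

lemma Cen_act: "\<psi> \<in> Cen R M \<phi> \<Longrightarrow> p \<in> carrier (UP R) \<Longrightarrow> u \<in> carrier M \<Longrightarrow>
    \<psi> (act p u) = act p (\<psi> u)"
  unfolding Cen_eq_End by (auto simp: End_alg_def)

lemma phi_pow_act:
  "p \<in> carrier (UP R) \<Longrightarrow> u \<in> carrier M \<Longrightarrow> act p ((\<phi> ^^ i) u) = (\<phi> ^^ i) (act p u)"
  by (induct i) (simp_all add: Cen_act[OF phi_mem_Cen, symmetric] phi_pow_closed)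

end

section \<open>The radical of a local ring\<close>

lemma zero_in_jacobson_radical: "ring R \<Longrightarrow> \<zero>\<^bsub>R\<^esub> \<in> jacobson_radical R"
  by (auto simp: jacobson_radical_def maximal_left_ideal_def left_ideal_def
      additive_subgroup.zero_closed ring.ring_simprules)

lemma jacobson_radical_closed: "a \<in> jacobson_radical R \<Longrightarrow> a \<in> carrier R"
  by (simp add: jacobson_radical_def)

lemma submoduleD: 
  assumes "submodule N R M"
  shows "N \<subseteq> carrier M" "\<zero>\<^bsub>M\<^esub> \<in> N" "\<And>r u. r \<in> carrier R \<Longrightarrow> u \<in> N \<Longrightarrow> r \<odot>\<^bsub>M\<^esub> u \<in> N"
  using subgroup.subset[OF submodule.axioms(1)[OF assms]]
    subgroup.one_closed[OF submodule.axioms(1)[OF assms]] submodule.smult_closed[OF assms]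
  by auto

context left_module
begin

lemma submodule_image_left_ideal:
  assumes L: "left_ideal L R" and v: "v \<in> carrier M"
  shows "submodule ((\<lambda>l. l \<odot>\<^bsub>M\<^esub> v) ` L) R M"
proof -
  have L': "L \<subseteq> carrier R" "L \<noteq> {}" "\<And>a b. a \<in> L \<Longrightarrow> b \<in> L \<Longrightarrow> a \<oplus> b \<in> L" "\<And>a. a \<in> L \<Longrightarrow> \<ominus> a \<in> L"
    "\<And>r a. r \<in> carrier R \<Longrightarrow> a \<in> L \<Longrightarrow> r \<otimes> a \<in> L"
    using L R.ring_axioms
    by (auto simp: left_ideal_def additive_subgroup.a_closed additive_subgroup.a_inv_closed R.is_abelian_group
        dest: additive_subgroup.a_subset additive_subgroup.zero_closed)
  interpret s: abelian_group_hom R M "\<lambda>l. l \<odot>\<^bsub>M\<^esub> v" by (rule scalar_hom[OF v])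
  show ?thesis
  proof (intro submodule.intro submodule_axioms.intro M.add.subgroupI)
    fix a assume "a \<in> (\<lambda>l. l \<odot>\<^bsub>M\<^esub> v) ` L"
    then obtain l where l: "l \<in> L" "a = l \<odot>\<^bsub>M\<^esub> v" by blast
    then have "\<ominus>\<^bsub>M\<^esub> a = (\<ominus> l) \<odot>\<^bsub>M\<^esub> v" using s.hom_a_inv[of l] L'(1) by auto
    then show "\<ominus>\<^bsub>M\<^esub> a \<in> (\<lambda>l. l \<odot>\<^bsub>M\<^esub> v) ` L" using l L'(4) by blast
  next
    fix a b assume "a \<in> (\<lambda>l. l \<odot>\<^bsub>M\<^esub> v) ` L" "b \<in> (\<lambda>l. l \<odot>\<^bsub>M\<^esub> v) ` L"
    then obtain l l' where l: "l \<in> L" "a = l \<odot>\<^bsub>M\<^esub> v" "l' \<in> L" "b = l' \<odot>\<^bsub>M\<^esub> v" by blast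
    then have "a \<oplus>\<^bsub>M\<^esub> b = (l \<oplus> l') \<odot>\<^bsub>M\<^esub> v" using smult_l_distr[OF subsetD[OF L'(1)] subsetD[OF L'(1)] v] by simp
    then show "a \<oplus>\<^bsub>M\<^esub> b \<in> (\<lambda>l. l \<odot>\<^bsub>M\<^esub> v) ` L" using l L'(3) by blast
  next
    fix r a assume "r \<in> carrier R" "a \<in> (\<lambda>l. l \<odot>\<^bsub>M\<^esub> v) ` L"
    then obtain l where l: "l \<in> L" "r \<odot>\<^bsub>M\<^esub> a = (r \<otimes> l) \<odot>\<^bsub>M\<^esub> v"
      using smult_assoc[OF _ subsetD[OF L'(1)] v] by fastforce
    then show "r \<odot>\<^bsub>M\<^esub> a \<in> (\<lambda>l. l \<odot>\<^bsub>M\<^esub> v) ` L" using \<open>r \<in> carrier R\<close> L'(5) by blast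
  qed (use L' v smult_closed in auto)
qed

lemma left_ideal_carrier: "left_ideal (carrier R) R"
  unfolding left_ideal_def additive_subgroup_def
  using R.add.subgroup_self by auto

lemma left_ideal_annihilator:
  assumes v: "v \<in> carrier M"
  shows "left_ideal {r \<in> carrier R. r \<odot>\<^bsub>M\<^esub> v = \<zero>\<^bsub>M\<^esub>} R"
proof -
  interpret s: abelian_group_hom R M "\<lambda>l. l \<odot>\<^bsub>M\<^esub> v" by (rule scalar_hom[OF v])
  show ?thesis
    unfolding left_ideal_def
  proof (intro conjI additive_subgroup.intro R.add.subgroupI)
    show "{r \<in> carrier R. r \<odot>\<^bsub>M\<^esub> v = \<zero>\<^bsub>M\<^esub>} \<noteq> {}" using s.hom_zero R.zero_closed by blast
  qed (use v in \<open>auto simp: smult_l_distr smult_assoc s.hom_a_inv\<close>)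
qed

text \<open>A left ideal between the annihilator of \<open>v\<close> and \<open>R\<close> is determined by the submodule \<open>L v\<close> of the simple
  module \<open>R v\<close>.\<close>

lemma maximal_left_ideal_annihilator:
  assumes v: "v \<in> carrier M" and simple: "simple_submodule (cyclic_submodule R M v) R M"
  shows "maximal_left_ideal {r \<in> carrier R. r \<odot>\<^bsub>M\<^esub> v = \<zero>\<^bsub>M\<^esub>} R"
proof -
  let ?A = "{r \<in> carrier R. r \<odot>\<^bsub>M\<^esub> v = \<zero>\<^bsub>M\<^esub>}"
  interpret s: abelian_group_hom R M "\<lambda>l. l \<odot>\<^bsub>M\<^esub> v" by (rule scalar_hom[OF v])
  have "?A \<noteq> carrier R"
  proof
    assume "?A = carrier R"
    then have "cyclic_submodule R M v = {\<zero>\<^bsub>M\<^esub>}"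
      using v by (auto simp: cyclic_submodule_def image_iff intro!: bexI[of _ "\<zero>"])
    then show False using simple by (simp add: simple_submodule_def)
  qed
  moreover have "L = ?A \<or> L = carrier R" if L: "left_ideal L R" "?A \<subseteq> L" for L
  proof -
    have Lc: "L \<subseteq> carrier R" and La: "\<And>a b. a \<in> L \<Longrightarrow> b \<in> L \<Longrightarrow> a \<oplus> b \<in> L"
      using L(1) by (auto simp: left_ideal_def additive_subgroup.a_closed dest: additive_subgroup.a_subset)
    let ?N = "(\<lambda>l. l \<odot>\<^bsub>M\<^esub> v) ` L"
    have "?N = {\<zero>\<^bsub>M\<^esub>} \<or> ?N = cyclic_submodule R M v"
      using simple submodule_image_left_ideal[OF L(1) v] Lc
      unfolding simple_submodule_def cyclic_submodule_def by blast
    then show ?thesis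
    proof
      assume "?N = {\<zero>\<^bsub>M\<^esub>}" then show ?thesis using Lc L(2) by blast
    next
      assume N: "?N = cyclic_submodule R M v"
      have "r \<in> L" if r: "r \<in> carrier R" for r
      proof -
        obtain l where l: "l \<in> L" "r \<odot>\<^bsub>M\<^esub> v = l \<odot>\<^bsub>M\<^esub> v"
          using N r unfolding cyclic_submodule_def by blast
        have lc: "l \<in> carrier R" using l Lc by blast
        have "(r \<oplus> \<ominus> l) \<odot>\<^bsub>M\<^esub> v = \<zero>\<^bsub>M\<^esub>"
          using r lc l(2) s.hom_a_inv[OF lc] v by (simp add: smult_l_distr M.r_neg smult_closed)
        then have "r \<oplus> \<ominus> l \<in> L" using L(2) r lc by auto
        from La[OF this l(1)] show ?thesis using r lc by (simp add: R.a_assoc R.l_neg)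
      qed
      then show ?thesis using Lc by blast
    qed
  qed
  ultimately show ?thesis
    using left_ideal_annihilator[OF v] by (auto simp: maximal_left_ideal_def)
qed

text \<open>Being a maximal left ideal, the annihilator contains \<open>J\<close>. If it contained some \<open>r\<close> outside \<open>J\<close>, then
  \<open>r\<close> would be invertible modulo \<open>J\<close>, and \<open>s r = j + 1\<close> with \<open>j\<close> in \<open>J\<close> gives \<open>0 = s r v = j v + v = v\<close>.\<close>

lemma annihilator_eq_jacobson_radical:
  assumes local: "local_ring R" and v: "v \<in> carrier M"
    and simple: "simple_submodule (cyclic_submodule R M v) R M"
  shows "{r \<in> carrier R. r \<odot>\<^bsub>M\<^esub> v = \<zero>\<^bsub>M\<^esub>} = jacobson_radical R"
proof
  let ?A = "{r \<in> carrier R. r \<odot>\<^bsub>M\<^esub> v = \<zero>\<^bsub>M\<^esub>}"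
  let ?J = "jacobson_radical R"
  have max: "maximal_left_ideal ?A R" by (rule maximal_left_ideal_annihilator[OF v simple])
  then show JA: "?J \<subseteq> ?A" unfolding jacobson_radical_def by blast
  show "?A \<subseteq> ?J"
  proof
    fix r assume r: "r \<in> ?A"
    show "r \<in> ?J"
    proof (rule ccontr)
      assume "r \<notin> ?J"
      have J0: "\<zero> \<in> ?J" by (rule zero_in_jacobson_radical[OF R.ring_axioms])
      have self: "a \<in> ?J +> a" if "a \<in> carrier R" for a
        using J0 that R.l_zero[OF that] unfolding a_r_coset_def' by force
      have "?J +> r \<in> carrier (R Quot ?J)"
        using r by (auto simp: FactRing_def A_RCOSETS_def')
      moreover have "?J +> r \<noteq> \<zero>\<^bsub>R Quot ?J\<^esub>"
        using self[of r] r \<open>r \<notin> ?J\<close> by (auto simp: FactRing_def)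
      ultimately have "?J +> r \<in> Units (R Quot ?J)"
        using local by (simp add: local_ring_def skew_field_def)
      then obtain C where "C \<in> carrier (R Quot ?J)" and C: "C \<otimes>\<^bsub>R Quot ?J\<^esub> (?J +> r) = \<one>\<^bsub>R Quot ?J\<^esub>"
        unfolding Units_def by blast
      then obtain s where s: "s \<in> carrier R" "C = ?J +> s"
        by (auto simp: FactRing_def A_RCOSETS_def')
      have "s \<otimes> r \<in> C \<otimes>\<^bsub>R Quot ?J\<^esub> (?J +> r)"
        using self[OF s(1)] self[of r] self[of "s \<otimes> r"] r s
        by (auto simp: FactRing_def rcoset_mult_def)
      then have "s \<otimes> r \<in> ?J +> \<one>" using C by (simp add: FactRing_def)
      then obtain j where j: "j \<in> ?J" "s \<otimes> r = j \<oplus> \<one>" unfolding a_r_coset_def' by blast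
      have "\<zero>\<^bsub>M\<^esub> = (s \<otimes> r) \<odot>\<^bsub>M\<^esub> v" using s r v by (simp add: smult_assoc)
      also have "\<dots> = v" using j JA v by (auto simp: smult_l_distr smult_one)
      finally have v0: "v = \<zero>\<^bsub>M\<^esub>" by simp
      have "?A = carrier R" unfolding v0 by auto
      then show False using max by (simp add: maximal_left_ideal_def)
    qed
  qed
qed

text \<open>Every nonzero element of a simple module generates it, so the preceding lemma applies to each of
  them.\<close>

lemma jacobson_radical_annihilates_simple:
  assumes local: "local_ring R" and N: "simple_submodule N R M"
    and a: "a \<in> jacobson_radical R" and w: "w \<in> N"
  shows "a \<odot>\<^bsub>M\<^esub> w = \<zero>\<^bsub>M\<^esub>"
proof (cases "w = \<zero>\<^bsub>M\<^esub>")
  case True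
  then show ?thesis using jacobson_radical_closed[OF a] by simp
next
  case False
  have sub: "submodule N R M" using N by (simp add: simple_submodule_def)
  have wM: "w \<in> carrier M" using submoduleD(1)[OF sub] w by blast
  have "submodule (cyclic_submodule R M w) R M"
    unfolding cyclic_submodule_def by (rule submodule_image_left_ideal[OF left_ideal_carrier wM])
  moreover have "cyclic_submodule R M w \<subseteq> N"
    using submoduleD(3)[OF sub] w by (auto simp: cyclic_submodule_def)
  moreover have "w \<in> cyclic_submodule R M w"
    unfolding cyclic_submodule_def using smult_one[OF wM] R.one_closed by force
  ultimately have "cyclic_submodule R M w = N"
    using N False unfolding simple_submodule_def by blast
  then show ?thesis using annihilator_eq_jacobson_radical[OF local wM] N a by auto
qed

end

section \<open>Congruences of polynomials\<close>

text \<open>Congruence modulo \<open>J[z] + (z\<^sup>n)\<close> only concerns the coefficients below \<open>n\<close>: cut a polynomial at the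
  exponent \<open>n\<close>. All three sets of matrices are described through this criterion.\<close>

lemma radical_plus_z_ideal:
  assumes "ring R"
  shows "radical_poly R <+>\<^bsub>UP R\<^esub> z_ideal R n
       = {p \<in> carrier (UP R). \<forall>i<n. coeff (UP R) p i \<in> jacobson_radical R}"
proof -
  interpret R: ring R by fact
  interpret UP_ring R "UP R" by unfold_locales
  have J0: "\<zero>\<^bsub>R\<^esub> \<in> jacobson_radical R" by (rule zero_in_jacobson_radical[OF assms])
  show ?thesis
  proof (intro equalityI subsetI)
    fix p assume "p \<in> radical_poly R <+>\<^bsub>UP R\<^esub> z_ideal R n"
    then obtain j q where j: "j \<in> radical_poly R" and q: "q \<in> carrier (UP R)"
      and p: "p = j \<oplus>\<^bsub>UP R\<^esub> monom (UP R) \<one>\<^bsub>R\<^esub> n \<otimes>\<^bsub>UP R\<^esub> q"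
      by (auto simp: set_add_def' z_ideal_def z_pow_def)
    then show "p \<in> {p \<in> carrier (UP R). \<forall>i<n. coeff (UP R) p i \<in> jacobson_radical R}"
      by (auto simp: radical_poly_def coeff_monom_mult simp del: coeff_mult)
  next
    fix p assume p: "p \<in> {p \<in> carrier (UP R). \<forall>i<n. coeff (UP R) p i \<in> jacobson_radical R}"
    let ?c = "coeff (UP R) p"
    define j where "j = (\<lambda>i. if i < n then ?c i else \<zero>\<^bsub>R\<^esub>)"
    define q where "q = (\<lambda>i. ?c (n + i))"
    have up: "j \<in> up R" "q \<in> up R"
      using p deg_aboveD[where p = p] unfolding j_def q_def
      by (auto intro!: mem_upI exI[of _ n] exI[of _ "deg R p"])
    then have c: "j \<in> carrier (UP R)" "q \<in> carrier (UP R)" "coeff (UP R) j = j" "coeff (UP R) q = q"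
      by (auto simp: UP_def)
    have "p = j \<oplus>\<^bsub>UP R\<^esub> monom (UP R) \<one>\<^bsub>R\<^esub> n \<otimes>\<^bsub>UP R\<^esub> q"
      by (rule up_eqI) (use p c in \<open>auto simp: coeff_monom_mult j_def q_def simp del: coeff_mult\<close>)
    moreover have "j \<in> radical_poly R" using p c J0 by (auto simp: radical_poly_def) (auto simp: j_def)
    ultimately show "p \<in> radical_poly R <+>\<^bsub>UP R\<^esub> z_ideal R n"
      using c(2) unfolding set_add_def' z_ideal_def z_pow_def by blast
  qed
qed

section \<open>Jordan normal bases\<close>

locale jordan_base = module_endomorphism R M \<phi>
  for R :: "('a, 'c) ring_scheme" (structure) and M :: "('a, 'b, 'd) module_scheme" (structure)
    and \<phi> :: "'b \<Rightarrow> 'b" +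
  fixes \<Gamma> :: "'i set" and k :: "'i \<Rightarrow> nat" and x :: "'i \<Rightarrow> nat \<Rightarrow> 'b"
  assumes local: "local_ring R" and finite_index: "finite \<Gamma>"
    and base: "nilpotent_Jordan_base R M \<phi> \<Gamma> k x"
begin

abbreviation J :: "'a set" where "J \<equiv> jacobson_radical R"
abbreviation S :: "('i \<times> nat) set" where "S \<equiv> SIGMA \<gamma>:\<Gamma>. {1..k \<gamma>}"

lemma k_pos: "\<gamma> \<in> \<Gamma> \<Longrightarrow> 1 \<le> k \<gamma>"
  and x_closed: "\<gamma> \<in> \<Gamma> \<Longrightarrow> i \<in> {1..k \<gamma>} \<Longrightarrow> x \<gamma> i \<in> carrier M"
  and x_simple: "\<gamma> \<in> \<Gamma> \<Longrightarrow> i \<in> {1..k \<gamma>} \<Longrightarrow> simple_submodule (cyclic_submodule R M (x \<gamma> i)) R M"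
  and direct_sum: "is_direct_sum R M S (\<lambda>(\<gamma>, i). cyclic_submodule R M (x \<gamma> i))"
  and phi_x: "\<gamma> \<in> \<Gamma> \<Longrightarrow> i \<in> {1..<k \<gamma>} \<Longrightarrow> \<phi> (x \<gamma> i) = x \<gamma> (i + 1)"
  and phi_x_last: "\<gamma> \<in> \<Gamma> \<Longrightarrow> \<phi> (x \<gamma> (k \<gamma>)) = \<zero>\<^bsub>M\<^esub>"
  using base unfolding nilpotent_Jordan_base_def by blast+

lemma finite_S: "finite S" using finite_index by auto

lemma J_zero: "\<zero> \<in> J" by (rule zero_in_jacobson_radical[OF R.ring_axioms])

lemma smult_x_eq_zero:
  "\<gamma> \<in> \<Gamma> \<Longrightarrow> i \<in> {1..k \<gamma>} \<Longrightarrow> r \<in> carrier R \<Longrightarrow> r \<odot>\<^bsub>M\<^esub> x \<gamma> i = \<zero>\<^bsub>M\<^esub> \<longleftrightarrow> r \<in> J"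
  using annihilator_eq_jacobson_radical[OF local x_closed x_simple] by blast

text \<open>Directness of the sum, in terms of coefficients: existence of decompositions here, their uniqueness in
  the form of \<open>base_independent\<close> below, where a coefficient that kills a base element lies in \<open>J\<close>.\<close>

lemma base_spanning:
  assumes "y \<in> carrier M"
  obtains r where "\<And>\<gamma> i. (\<gamma>, i) \<in> S \<Longrightarrow> r \<gamma> i \<in> carrier R"
    "y = finsum M (\<lambda>(\<gamma>, i). r \<gamma> i \<odot>\<^bsub>M\<^esub> x \<gamma> i) S"
proof -
  obtain f where f: "f \<in> (\<Pi>\<^sub>E s\<in>S. (\<lambda>(\<gamma>, i). cyclic_submodule R M (x \<gamma> i)) s)"
    "y = (\<Oplus>\<^bsub>M\<^esub>s\<in>{s\<in>S. f s \<noteq> \<zero>\<^bsub>M\<^esub>}. f s)"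
    using direct_sum assms unfolding is_direct_sum_def by blast
  have "\<forall>s\<in>S. \<exists>r\<in>carrier R. f s = r \<odot>\<^bsub>M\<^esub> x (fst s) (snd s)"
    using f(1) by (fastforce simp: PiE_iff cyclic_submodule_def)
  then obtain r where r: "\<And>s. s \<in> S \<Longrightarrow> r s \<in> carrier R"
    "\<And>s. s \<in> S \<Longrightarrow> f s = r s \<odot>\<^bsub>M\<^esub> x (fst s) (snd s)" by metis
  have "y = finsum M (\<lambda>(\<gamma>, i). r (\<gamma>, i) \<odot>\<^bsub>M\<^esub> x \<gamma> i) S"
    unfolding f(2)
    by (rule M.add.finprod_mono_neutral_cong_left)
      (use finite_S r x_closed in \<open>auto intro!: smult_closed\<close>)
  then show thesis using that[of "\<lambda>\<gamma> i. r (\<gamma>, i)"] r(1) by auto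
qed

lemma base_independent:
  assumes r: "\<And>\<gamma> i. (\<gamma>, i) \<in> S \<Longrightarrow> r \<gamma> i \<in> carrier R"
    and zero: "finsum M (\<lambda>(\<gamma>, i). r \<gamma> i \<odot>\<^bsub>M\<^esub> x \<gamma> i) S = \<zero>\<^bsub>M\<^esub>"
    and s: "(\<gamma>, i) \<in> S"
  shows "r \<gamma> i \<in> J"
proof -
  let ?C = "\<lambda>(\<gamma>, i). cyclic_submodule R M (x \<gamma> i)"
  let ?Q = "\<lambda>f. f \<in> (\<Pi>\<^sub>E s\<in>S. ?C s) \<and> finite {s\<in>S. f s \<noteq> \<zero>\<^bsub>M\<^esub>} \<and>
        \<zero>\<^bsub>M\<^esub> = (\<Oplus>\<^bsub>M\<^esub>s\<in>{s\<in>S. f s \<noteq> \<zero>\<^bsub>M\<^esub>}. f s)"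
  define f where "f = (\<lambda>(\<gamma>, i)\<in>S. r \<gamma> i \<odot>\<^bsub>M\<^esub> x \<gamma> i)"
  \<comment> \<open>Both \<open>f\<close> and the zero family decompose \<open>0\<close>, so they agree.\<close>
  have ex: "\<exists>!f. ?Q f" using direct_sum unfolding is_direct_sum_def by blast
  have "?Q f"
  proof (intro conjI)
    show "f \<in> (\<Pi>\<^sub>E s\<in>S. ?C s)"
      unfolding f_def using r by (auto simp: cyclic_submodule_def)
    show "finite {s\<in>S. f s \<noteq> \<zero>\<^bsub>M\<^esub>}" using finite_S by auto
    have "(\<Oplus>\<^bsub>M\<^esub>s\<in>{s\<in>S. f s \<noteq> \<zero>\<^bsub>M\<^esub>}. f s) = finsum M (\<lambda>(\<gamma>, i). r \<gamma> i \<odot>\<^bsub>M\<^esub> x \<gamma> i) S"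
      by (rule M.add.finprod_mono_neutral_cong_left)
        (use finite_S r x_closed in \<open>auto simp: f_def intro!: smult_closed\<close>)
    then show "\<zero>\<^bsub>M\<^esub> = (\<Oplus>\<^bsub>M\<^esub>s\<in>{s\<in>S. f s \<noteq> \<zero>\<^bsub>M\<^esub>}. f s)" using zero by simp
  qed
  moreover have "?Q (\<lambda>s\<in>S. \<zero>\<^bsub>M\<^esub>)"
  proof -
    have "\<zero>\<^bsub>M\<^esub> \<in> ?C s" if "s \<in> S" for s
      using that x_closed by (force simp: cyclic_submodule_def image_iff intro!: bexI[of _ \<zero>])
    moreover have "{s\<in>S. (\<lambda>s\<in>S. \<zero>\<^bsub>M\<^esub>) s \<noteq> \<zero>\<^bsub>M\<^esub>} = {}" by auto
    ultimately show ?thesis by (simp only: finite.emptyI M.finsum_empty) auto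
  qed
  ultimately have "f = (\<lambda>s\<in>S. \<zero>\<^bsub>M\<^esub>)" using ex by blast
  from fun_cong[OF this, of "(\<gamma>, i)"] have "r \<gamma> i \<odot>\<^bsub>M\<^esub> x \<gamma> i = \<zero>\<^bsub>M\<^esub>" using s by (simp add: f_def)
  then show ?thesis using smult_x_eq_zero[of \<gamma> i "r \<gamma> i"] r s by auto
qed

lemma phi_pow_x:
  "\<gamma> \<in> \<Gamma> \<Longrightarrow> (\<phi> ^^ i) (x \<gamma> (Suc 0)) = (if i < k \<gamma> then x \<gamma> (Suc i) else \<zero>\<^bsub>M\<^esub>)"
proof (induct i)
  case 0
  then show ?case using k_pos[of \<gamma>] by simp
next
  case (Suc i)
  consider "Suc i < k \<gamma>" | "Suc i = k \<gamma>" | "k \<gamma> \<le> i" by linarith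
  then show ?case
  proof cases
    case 1
    then show ?thesis using Suc phi_x[of \<gamma> "Suc i"] by simp
  next
    case 2
    then show ?thesis using Suc phi_x_last[of \<gamma>] by (simp flip: 2)
  next
    case 3
    then show ?thesis using Suc End_zero[OF phi_End] by simp
  qed
qed

lemma x1_closed: "\<gamma> \<in> \<Gamma> \<Longrightarrow> x \<gamma> (Suc 0) \<in> carrier M"
  using x_closed k_pos by auto

text \<open>Since \<open>\<phi>\<close> shifts each chain of the base, the coefficient of \<open>z\<^sup>i\<close> becomes the coefficient of the
  \<open>(i + 1)\<close>-st element of the chain, and terms beyond the end of the chain vanish.\<close>

lemma act_x:
  assumes p: "p \<in> carrier (UP R)" and \<gamma>: "\<gamma> \<in> \<Gamma>"
  shows "act p (x \<gamma> (Suc 0)) = (\<Oplus>\<^bsub>M\<^esub>i\<in>{1..k \<gamma>}. coeff (UP R) p (i - 1) \<odot>\<^bsub>M\<^esub> x \<gamma> i)"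
proof -
  let ?n = "max (deg R p) (k \<gamma>)"
  have "(\<Oplus>\<^bsub>M\<^esub>i\<in>{1..k \<gamma>}. coeff (UP R) p (i - 1) \<odot>\<^bsub>M\<^esub> x \<gamma> i)
      = (\<Oplus>\<^bsub>M\<^esub>i\<in>Suc ` {..<k \<gamma>}. coeff (UP R) p (i - 1) \<odot>\<^bsub>M\<^esub> x \<gamma> i)"
    by (simp add: image_Suc_lessThan)
  also have "\<dots> = (\<Oplus>\<^bsub>M\<^esub>i\<in>{..<k \<gamma>}. coeff (UP R) p i \<odot>\<^bsub>M\<^esub> x \<gamma> (Suc i))"
    by (subst M.finsum_reindex) (use p \<gamma> x_closed in \<open>auto intro!: smult_closed\<close>)
  also have "\<dots> = (\<Oplus>\<^bsub>M\<^esub>i\<in>{..?n}. coeff (UP R) p i \<odot>\<^bsub>M\<^esub> (\<phi> ^^ i) (x \<gamma> (Suc 0)))"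
    by (rule M.add.finprod_mono_neutral_cong_left)
      (use p \<gamma> x_closed in \<open>auto simp: phi_pow_x intro!: smult_closed\<close>)
  also have "\<dots> = act p (x \<gamma> (Suc 0))"
    using act_eq[OF p _ x1_closed[OF \<gamma>], of ?n] by simp
  finally show ?thesis by simp
qed

lemma finsum_act_x:
  assumes f: "f \<in> \<Gamma> \<rightarrow> carrier (UP R)"
  shows "(\<Oplus>\<^bsub>poly_module R M \<phi>\<^esub>\<gamma>\<in>\<Gamma>. act (f \<gamma>) (x \<gamma> (Suc 0)))
       = finsum M (\<lambda>(\<gamma>, i). coeff (UP R) (f \<gamma>) (i - 1) \<odot>\<^bsub>M\<^esub> x \<gamma> i) S"
proof -
  have fc: "\<gamma> \<in> \<Gamma> \<Longrightarrow> f \<gamma> \<in> carrier (UP R)" for \<gamma> using f by auto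
  have "(\<Oplus>\<^bsub>poly_module R M \<phi>\<^esub>\<gamma>\<in>\<Gamma>. act (f \<gamma>) (x \<gamma> (Suc 0))) = (\<Oplus>\<^bsub>M\<^esub>\<gamma>\<in>\<Gamma>. act (f \<gamma>) (x \<gamma> (Suc 0)))"
    by (rule finsum_cong_structure[OF M.abelian_group_axioms poly_module_abelian_group])
      (use fc x1_closed act_closed in auto)
  also have "\<dots> = (\<Oplus>\<^bsub>M\<^esub>\<gamma>\<in>\<Gamma>. \<Oplus>\<^bsub>M\<^esub>i\<in>{1..k \<gamma>}. coeff (UP R) (f \<gamma>) (i - 1) \<odot>\<^bsub>M\<^esub> x \<gamma> i)"
    by (rule M.finsum_cong')
      (use fc act_x[OF fc] x_closed in \<open>auto intro!: M.finsum_closed smult_closed\<close>)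
  also have "\<dots> = finsum M (\<lambda>(\<gamma>, i). coeff (UP R) (f \<gamma>) (i - 1) \<odot>\<^bsub>M\<^esub> x \<gamma> i) S"
    by (rule M.finsum_Sigma) (use finite_index fc x_closed in \<open>auto intro!: smult_closed\<close>)
  finally show ?thesis .
qed

text \<open>The first elements of the chains generate the polynomial module: a combination of the chain of \<open>\<gamma>\<close>
  is \<open>f \<gamma>\<close> applied to its first element, for the polynomial \<open>f \<gamma>\<close> of degree below \<open>k \<gamma>\<close> with the
  same coefficients.\<close>

sublocale G: finitely_generated_module "UP R" "poly_module R M \<phi>" \<Gamma> "\<lambda>\<gamma>. x \<gamma> (Suc 0)"
proof (intro finitely_generated_module.intro finitely_generated_module_axioms.intro
    poly_module_left_module finite_index)
  show "(\<lambda>\<gamma>. x \<gamma> (Suc 0)) \<in> \<Gamma> \<rightarrow> carrier (poly_module R M \<phi>)" using x1_closed by simp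
  fix y assume "y \<in> carrier (poly_module R M \<phi>)"
  then have y: "y \<in> carrier M" by simp
  obtain r where r: "\<And>\<gamma> i. (\<gamma>, i) \<in> S \<Longrightarrow> r \<gamma> i \<in> carrier R"
    "y = finsum M (\<lambda>(\<gamma>, i). r \<gamma> i \<odot>\<^bsub>M\<^esub> x \<gamma> i) S" using base_spanning[OF y] by blast
  define f where "f \<gamma> = (\<lambda>i. if i < k \<gamma> then r \<gamma> (Suc i) else \<zero>)" for \<gamma>
  have up: "f \<gamma> \<in> up R" if "\<gamma> \<in> \<Gamma>" for \<gamma>
    unfolding f_def using r(1) that by (auto intro!: mem_upI exI[of _ "k \<gamma>"])
  then have f: "f \<gamma> \<in> carrier (UP R)" "coeff (UP R) (f \<gamma>) = f \<gamma>" if "\<gamma> \<in> \<Gamma>" for \<gamma>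
    using that by (auto simp: UP_def)
  have "y = finsum M (\<lambda>(\<gamma>, i). coeff (UP R) (f \<gamma>) (i - 1) \<odot>\<^bsub>M\<^esub> x \<gamma> i) S"
    unfolding r(2)
    by (rule M.finsum_cong') (use f r(1) x_closed in \<open>auto simp: f_def intro!: smult_closed\<close>)
  also have "\<dots> = (\<Oplus>\<^bsub>poly_module R M \<phi>\<^esub>\<gamma>\<in>\<Gamma>. act (f \<gamma>) (x \<gamma> (Suc 0)))"
    by (rule finsum_act_x[symmetric]) (use f in auto)
  finally show "\<exists>f\<in>\<Gamma> \<rightarrow> carrier (UP R). y = (\<Oplus>\<^bsub>poly_module R M \<phi>\<^esub>\<gamma>\<in>\<Gamma>. act (f \<gamma>) (x \<gamma> (Suc 0)))"
    using f by blast
qed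

text \<open>The relations between the first elements of the chains. With the criterion for congruence modulo
  \<open>J[z] + (z\<^sup>n)\<close> they become the condition that every \<open>f \<gamma>\<close> lies in \<open>J[z] + (z\<^sup>n)\<close> with \<open>n = k \<gamma>\<close>.\<close>

lemma comb_eq_zero:
  assumes f: "f \<in> \<Gamma> \<rightarrow> carrier (UP R)"
  shows "G.comb f = \<zero>\<^bsub>M\<^esub> \<longleftrightarrow> (\<forall>\<gamma>\<in>\<Gamma>. \<forall>i<k \<gamma>. coeff (UP R) (f \<gamma>) i \<in> J)"
proof
  have fc: "\<gamma> \<in> \<Gamma> \<Longrightarrow> f \<gamma> \<in> carrier (UP R)" for \<gamma> using f by auto
  have eq: "G.comb f = finsum M (\<lambda>(\<gamma>, i). coeff (UP R) (f \<gamma>) (i - 1) \<odot>\<^bsub>M\<^esub> x \<gamma> i) S"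
    unfolding G.comb_def by (rule finsum_act_x[OF f])
  {
    assume "G.comb f = \<zero>\<^bsub>M\<^esub>"
    then have "coeff (UP R) (f \<gamma>) (i - 1) \<in> J" if "(\<gamma>, i) \<in> S" for \<gamma> i
      using base_independent[of "\<lambda>\<gamma> i. coeff (UP R) (f \<gamma>) (i - 1)"] fc that unfolding eq by auto
    from this[of _ "Suc _"] show "\<forall>\<gamma>\<in>\<Gamma>. \<forall>i<k \<gamma>. coeff (UP R) (f \<gamma>) i \<in> J" by auto
  next
    assume c: "\<forall>\<gamma>\<in>\<Gamma>. \<forall>i<k \<gamma>. coeff (UP R) (f \<gamma>) i \<in> J"
    show "G.comb f = \<zero>\<^bsub>M\<^esub>"
      unfolding eq
      by (rule M.add.finprod_one_eqI) (use c smult_x_eq_zero fc in auto)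
  }
qed

lemma comb_eq_zero_iff_mem:
  assumes f: "f \<in> \<Gamma> \<rightarrow> carrier (UP R)"
  shows "G.comb f = \<zero>\<^bsub>M\<^esub> \<longleftrightarrow> (\<forall>\<gamma>\<in>\<Gamma>. f \<gamma> \<in> radical_poly R <+>\<^bsub>UP R\<^esub> z_ideal R (k \<gamma>))"
  unfolding comb_eq_zero[OF f] radical_plus_z_ideal[OF R.ring_axioms] using f by auto

lemma J_annihilates:
  assumes a: "a \<in> J" and u: "u \<in> carrier M"
  shows "a \<odot>\<^bsub>M\<^esub> u = \<zero>\<^bsub>M\<^esub>"
proof -
  have ac: "a \<in> carrier R" by (rule jacobson_radical_closed[OF a])
  obtain r where r: "\<And>\<gamma> i. (\<gamma>, i) \<in> S \<Longrightarrow> r \<gamma> i \<in> carrier R"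
    "u = finsum M (\<lambda>(\<gamma>, i). r \<gamma> i \<odot>\<^bsub>M\<^esub> x \<gamma> i) S" using base_spanning[OF u] by blast
  have "a \<odot>\<^bsub>M\<^esub> u = (\<Oplus>\<^bsub>M\<^esub>s\<in>S. a \<odot>\<^bsub>M\<^esub> (case s of (\<gamma>, i) \<Rightarrow> r \<gamma> i \<odot>\<^bsub>M\<^esub> x \<gamma> i))"
    unfolding r(2) by (rule smult_finsum[OF ac]) (use r x_closed in \<open>auto intro!: smult_closed\<close>)
  also have "\<dots> = \<zero>\<^bsub>M\<^esub>"
  proof (rule M.add.finprod_one_eqI)
    fix s assume s: "s \<in> S"
    obtain \<gamma> i where [simp]: "s = (\<gamma>, i)" by (cases s)
    show "a \<odot>\<^bsub>M\<^esub> (case s of (\<gamma>, i) \<Rightarrow> r \<gamma> i \<odot>\<^bsub>M\<^esub> x \<gamma> i) = \<zero>\<^bsub>M\<^esub>"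
      using jacobson_radical_annihilates_simple[OF local x_simple a, of \<gamma> i] r(1)[of \<gamma> i] s
      by (auto simp: cyclic_submodule_def)
  qed
  finally show ?thesis .
qed

lemma radical_poly_annihilates:
  assumes p: "p \<in> radical_poly R" and u: "u \<in> carrier M"
  shows "act p u = \<zero>\<^bsub>M\<^esub>"
proof -
  have "p \<in> carrier (UP R)" using p by (simp add: radical_poly_def)
  from act_eq[OF this order.refl u] show ?thesis
    using p u by (auto simp: radical_poly_def J_annihilates phi_pow_closed intro!: M.add.finprod_one_eqI)
qed

lemma mat_entry: "P \<in> carrier (mat_alg (UP R) \<Gamma>) \<Longrightarrow> \<delta> \<in> \<Gamma> \<Longrightarrow> \<gamma> \<in> \<Gamma> \<Longrightarrow> P (\<delta>, \<gamma>) \<in> carrier (UP R)"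
  by (auto simp: mat_alg_def)

lemma row_times_z_pow:
  assumes P: "P \<in> carrier (mat_alg (UP R) \<Gamma>)" and \<delta>: "\<delta> \<in> \<Gamma>"
  shows "G.comb (\<lambda>\<gamma>. z_pow R n \<otimes>\<^bsub>UP R\<^esub> P (\<delta>, \<gamma>)) = (\<phi> ^^ n) (G.comb (\<lambda>\<gamma>. P (\<delta>, \<gamma>)))"
proof -
  note row = G.row_closed[OF P \<delta>]
  have "G.comb (\<lambda>\<gamma>. P (\<delta>, \<gamma>)) \<in> carrier M" using G.comb_closed[OF row] by simp
  then show ?thesis
    using G.comb_smult[OF row, of "z_pow R n"]
    by (simp add: z_pow_def act_monom smult_one phi_pow_closed)
qed

text \<open>Membership in \<open>N(X)\<close> is exactly the condition that \<open>P\<close> maps relations to relations. Put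
  \<open>v \<delta>\<close> for the combination given by the \<open>\<delta>\<close>-th row; then \<open>P \<in> N(X)\<close> says that \<open>\<phi>\<^sup>n\<close> kills \<open>v \<delta>\<close> for
  \<open>n = k \<delta>\<close>. This is necessary for an endomorphism commuting with \<open>\<phi>\<close> that sends \<open>x \<delta> 1\<close> to \<open>v \<delta>\<close>, because
  \<open>\<phi>\<^sup>n\<close> kills \<open>x \<delta> 1\<close>. It is sufficient because a relation \<open>f\<close> has \<open>f \<delta> = j + z\<^sup>n q\<close> with \<open>j\<close> in \<open>J[z]\<close>, and
  \<open>J[z]\<close> annihilates the module.\<close>

lemma N_set_iff_represents:
  assumes P: "P \<in> carrier (mat_alg (UP R) \<Gamma>)"
  shows "P \<in> N_set R \<Gamma> k \<longleftrightarrow> (\<exists>\<psi>\<in>Cen R M \<phi>. G.represents P \<psi>)"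
proof -
  note row = G.row_closed[OF P]
  have zrow: "(\<lambda>\<gamma>. z_pow R n \<otimes>\<^bsub>UP R\<^esub> P (\<delta>, \<gamma>)) \<in> \<Gamma> \<rightarrow> carrier (UP R)" if "\<delta> \<in> \<Gamma>" for \<delta> n
    using mat_entry[OF P that] by (simp add: z_pow_def)
  have N: "P \<in> N_set R \<Gamma> k \<longleftrightarrow> (\<forall>\<delta>\<in>\<Gamma>. (\<phi> ^^ k \<delta>) (G.comb (\<lambda>\<gamma>. P (\<delta>, \<gamma>))) = \<zero>\<^bsub>M\<^esub>)"
    using P comb_eq_zero_iff_mem[OF zrow] row_times_z_pow[OF P] by (simp add: N_set_def)
  show ?thesis
  proof
    assume "P \<in> N_set R \<Gamma> k"
    then have z: "(\<phi> ^^ k \<delta>) (G.comb (\<lambda>\<gamma>. P (\<delta>, \<gamma>))) = \<zero>\<^bsub>M\<^esub>" if "\<delta> \<in> \<Gamma>" for \<delta>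
      using N that by simp
    have "\<exists>\<psi>\<in>carrier (End_alg (UP R) (poly_module R M \<phi>)). \<forall>\<delta>\<in>\<Gamma>. \<psi> (x \<delta> (Suc 0)) = G.comb (\<lambda>\<gamma>. P (\<delta>, \<gamma>))"
    proof (rule G.End_extension)
      show "(\<lambda>\<delta>. G.comb (\<lambda>\<gamma>. P (\<delta>, \<gamma>))) \<in> \<Gamma> \<rightarrow> carrier (poly_module R M \<phi>)"
        using G.comb_closed[OF row] by simp
      fix f assume f: "f \<in> \<Gamma> \<rightarrow> carrier (UP R)" and "G.comb f = \<zero>\<^bsub>poly_module R M \<phi>\<^esub>"
      then have mem: "f \<delta> \<in> radical_poly R <+>\<^bsub>UP R\<^esub> z_ideal R (k \<delta>)" if "\<delta> \<in> \<Gamma>" for \<delta>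
        using comb_eq_zero_iff_mem[OF f] that by simp
      show "(\<Oplus>\<^bsub>poly_module R M \<phi>\<^esub>\<delta>\<in>\<Gamma>. act (f \<delta>) (G.comb (\<lambda>\<gamma>. P (\<delta>, \<gamma>)))) = \<zero>\<^bsub>poly_module R M \<phi>\<^esub>"
      proof (rule G.M.add.finprod_one_eqI)
        fix \<delta> assume \<delta>: "\<delta> \<in> \<Gamma>"
        let ?u = "G.comb (\<lambda>\<gamma>. P (\<delta>, \<gamma>))"
        have u: "?u \<in> carrier M" using G.comb_closed[OF row[OF \<delta>]] by simp
        obtain j q where j: "j \<in> radical_poly R" and q: "q \<in> carrier (UP R)"
          and fd: "f \<delta> = j \<oplus>\<^bsub>UP R\<^esub> monom (UP R) \<one> (k \<delta>) \<otimes>\<^bsub>UP R\<^esub> q"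
          using mem[OF \<delta>] by (auto simp: set_add_def' z_ideal_def z_pow_def)
        have jc: "j \<in> carrier (UP R)" using j by (simp add: radical_poly_def)
        have "act (f \<delta>) ?u = act j ?u \<oplus>\<^bsub>M\<^esub> (\<phi> ^^ k \<delta>) (act q ?u)"
          unfolding fd using jc q u
          by (simp add: act_add_left act_monom_mult act_closed phi_pow_closed smult_one)
        also have "(\<phi> ^^ k \<delta>) (act q ?u) = act q ((\<phi> ^^ k \<delta>) ?u)"
          by (rule phi_pow_act[OF q u, symmetric])
        also have "\<dots> = \<zero>\<^bsub>M\<^esub>" using z[OF \<delta>] G.smult_r_null[OF q] by simp
        finally show "act (f \<delta>) ?u = \<zero>\<^bsub>poly_module R M \<phi>\<^esub>"
          using radical_poly_annihilates[OF j u] by simp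
      qed
    qed
    then show "\<exists>\<psi>\<in>Cen R M \<phi>. G.represents P \<psi>"
      unfolding Cen_eq_End G.represents_def .
  next
    assume "\<exists>\<psi>\<in>Cen R M \<phi>. G.represents P \<psi>"
    then obtain \<psi> where \<psi>: "\<psi> \<in> Cen R M \<phi>" and rep: "G.represents P \<psi>" by blast
    have "(\<phi> ^^ k \<delta>) (G.comb (\<lambda>\<gamma>. P (\<delta>, \<gamma>))) = \<zero>\<^bsub>M\<^esub>" if \<delta>: "\<delta> \<in> \<Gamma>" for \<delta>
    proof -
      have "(\<phi> ^^ k \<delta>) (\<psi> (x \<delta> (Suc 0))) = \<psi> ((\<phi> ^^ k \<delta>) (x \<delta> (Suc 0)))"
        by (rule Cen_phi_pow[OF \<psi> x1_closed[OF \<delta>], symmetric])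
      also have "\<dots> = \<zero>\<^bsub>M\<^esub>"
        using phi_pow_x[OF \<delta>] End_zero \<psi> by (simp add: Cen_def)
      finally show ?thesis using rep \<delta> by (simp add: G.represents_def)
    qed
    then show "P \<in> N_set R \<Gamma> k" using N by simp
  qed
qed

end

section \<open>The centralizer as an algebra of matrices\<close>

lemma (in left_module) End_center_smult:
  assumes "c \<in> ring_center R" "\<psi> \<in> carrier (End_alg R M)"
  shows "c \<odot>\<^bsub>End_alg R M\<^esub> \<psi> \<in> carrier (End_alg R M)"
proof -
  have c: "c \<in> carrier R" "\<And>r. r \<in> carrier R \<Longrightarrow> c \<otimes> r = r \<otimes> c"
    using assms(1) by (auto simp: ring_center_def)
  have "c \<odot>\<^bsub>M\<^esub> (r \<odot>\<^bsub>M\<^esub> y) = r \<odot>\<^bsub>M\<^esub> (c \<odot>\<^bsub>M\<^esub> y)" if "r \<in> carrier R" "y \<in> carrier M" for r y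
    using that c by (metis smult_assoc)
  then show ?thesis
    using assms(2) c(1) by (auto simp: End_alg_def smult_r_distr smult_closed PiE_iff)
qed

context module_endomorphism
begin

lemma Cen_alg_ring: "ring (Cen_alg R M \<phi>)"
  by (rule ring_cong[OF left_module.End_ring[OF poly_module_left_module]])
    (simp_all add: Cen_alg_def Cen_eq_End, simp_all add: End_alg_def)

lemma Cen_alg_simps:
  "carrier (Cen_alg R M \<phi>) = Cen R M \<phi>"
  "\<zero>\<^bsub>Cen_alg R M \<phi>\<^esub> = (\<lambda>u\<in>carrier M. \<zero>\<^bsub>M\<^esub>)"
  "\<psi> \<oplus>\<^bsub>Cen_alg R M \<phi>\<^esub> \<chi> = \<psi> \<oplus>\<^bsub>End_alg (UP R) (poly_module R M \<phi>)\<^esub> \<chi>"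
  "\<psi> \<otimes>\<^bsub>Cen_alg R M \<phi>\<^esub> \<chi> = \<psi> \<otimes>\<^bsub>End_alg (UP R) (poly_module R M \<phi>)\<^esub> \<chi>"
  "c \<odot>\<^bsub>Cen_alg R M \<phi>\<^esub> \<psi> = (\<lambda>u\<in>carrier M. c \<odot>\<^bsub>M\<^esub> \<psi> u)"
  by (simp_all add: Cen_alg_def End_alg_def)

lemma Cen0_eq: "Cen0 R M \<phi> = {\<psi> \<in> Cen R M \<phi>. \<phi> \<otimes>\<^bsub>Cen_alg R M \<phi>\<^esub> \<psi> = \<zero>\<^bsub>Cen_alg R M \<phi>\<^esub>}"
  by (auto simp: Cen0_def Cen_def Cen_alg_def)

lemma Cen_commutes:
  "\<psi> \<in> Cen R M \<phi> \<Longrightarrow> \<phi> \<otimes>\<^bsub>Cen_alg R M \<phi>\<^esub> \<psi> = \<psi> \<otimes>\<^bsub>Cen_alg R M \<phi>\<^esub> \<phi>"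
  by (simp add: Cen_def Cen_alg_def)

text \<open>In its centralizer \<open>\<phi>\<close> is a central element, so that its annihilator there is a two-sided ideal.\<close>

lemma Cen0_ideal: "ideal (Cen0 R M \<phi>) (Cen_alg R M \<phi>)"
proof -
  interpret C: ring "Cen_alg R M \<phi>" by (rule Cen_alg_ring)
  have phi: "\<phi> \<in> carrier (Cen_alg R M \<phi>)" using phi_mem_Cen by (simp add: Cen_alg_simps)
  have mem: "\<psi> \<in> Cen0 R M \<phi> \<longleftrightarrow> \<psi> \<in> carrier (Cen_alg R M \<phi>) \<and>
      \<phi> \<otimes>\<^bsub>Cen_alg R M \<phi>\<^esub> \<psi> = \<zero>\<^bsub>Cen_alg R M \<phi>\<^esub>" for \<psi>
    unfolding Cen0_eq by (simp add: Cen_alg_simps(1))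
  have comm: "\<phi> \<otimes>\<^bsub>Cen_alg R M \<phi>\<^esub> \<psi> = \<psi> \<otimes>\<^bsub>Cen_alg R M \<phi>\<^esub> \<phi>"
    if "\<psi> \<in> carrier (Cen_alg R M \<phi>)" for \<psi>
    using that Cen_commutes by (simp add: Cen_alg_simps(1))
  show ?thesis
  proof (rule idealI[OF Cen_alg_ring])
    show "subgroup (Cen0 R M \<phi>) (add_monoid (Cen_alg R M \<phi>))"
    proof (rule C.add.subgroupI)
      show "Cen0 R M \<phi> \<noteq> {}"
        using phi mem[of "\<zero>\<^bsub>Cen_alg R M \<phi>\<^esub>"] by auto
    qed (use phi in \<open>auto simp: mem C.r_distr C.r_minus\<close>)
    fix \<psi> \<chi> assume "\<psi> \<in> Cen0 R M \<phi>" and \<chi>: "\<chi> \<in> carrier (Cen_alg R M \<phi>)"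
    then have \<psi>: "\<psi> \<in> carrier (Cen_alg R M \<phi>)"
      "\<phi> \<otimes>\<^bsub>Cen_alg R M \<phi>\<^esub> \<psi> = \<zero>\<^bsub>Cen_alg R M \<phi>\<^esub>" by (auto simp: mem)
    show "\<psi> \<otimes>\<^bsub>Cen_alg R M \<phi>\<^esub> \<chi> \<in> Cen0 R M \<phi>"
      using \<psi> \<chi> phi by (simp add: mem C.m_assoc[symmetric])
    show "\<chi> \<otimes>\<^bsub>Cen_alg R M \<phi>\<^esub> \<psi> \<in> Cen0 R M \<phi>"
      using \<psi> \<chi> phi comm[OF \<chi>] C.m_assoc[OF phi \<chi> \<psi>(1)] C.m_assoc[OF \<chi> phi \<psi>(1)]
      by (simp add: mem)
  qed
qed

lemma Cen_smult:
  assumes c: "c \<in> ring_center R" and \<psi>: "\<psi> \<in> Cen R M \<phi>"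
  shows "c \<odot>\<^bsub>Cen_alg R M \<phi>\<^esub> \<psi> \<in> Cen R M \<phi>"
proof -
  have cc: "c \<in> carrier R" using c by (simp add: ring_center_def)
  have \<psi>E: "\<psi> \<in> carrier (End_alg R M)" using \<psi> by (simp add: Cen_def)
  have "c \<odot>\<^bsub>Cen_alg R M \<phi>\<^esub> \<psi> \<in> carrier (End_alg R M)"
    using End_center_smult[OF c \<psi>E] by (simp add: Cen_alg_def)
  moreover have "compose (carrier M) (\<lambda>u\<in>carrier M. c \<odot>\<^bsub>M\<^esub> \<psi> u) \<phi> = compose (carrier M) \<phi> (\<lambda>u\<in>carrier M. c \<odot>\<^bsub>M\<^esub> \<psi> u)"
    using End_closed[OF \<psi>E] End_closed[OF phi_End] Cen_phi[OF \<psi>] cc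
    by (auto simp: compose_def fun_eq_iff End_smult[OF phi_End])
  ultimately show ?thesis
    by (simp add: Cen_alg_simps(5)) (simp add: Cen_def End_alg_def)
qed

lemma Cen0_smult:
  assumes c: "c \<in> ring_center R" and \<psi>: "\<psi> \<in> Cen0 R M \<phi>"
  shows "c \<odot>\<^bsub>Cen_alg R M \<phi>\<^esub> \<psi> \<in> Cen0 R M \<phi>"
proof -
  have cc: "c \<in> carrier R" using c by (simp add: ring_center_def)
  have \<psi>C: "\<psi> \<in> Cen R M \<phi>" and z: "compose (carrier M) \<phi> \<psi> = (\<lambda>u\<in>carrier M. \<zero>\<^bsub>M\<^esub>)"
    using \<psi> by (auto simp: Cen0_eq Cen_alg_def End_alg_def)
  have \<psi>E: "\<psi> \<in> carrier (End_alg R M)" using \<psi>C by (simp add: Cen_def)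
  have "\<phi> (\<psi> u) = \<zero>\<^bsub>M\<^esub>" if "u \<in> carrier M" for u
    using fun_cong[OF z, of u] that by (simp add: compose_def)
  then have "compose (carrier M) \<phi> (\<lambda>u\<in>carrier M. c \<odot>\<^bsub>M\<^esub> \<psi> u) = (\<lambda>u\<in>carrier M. \<zero>\<^bsub>M\<^esub>)"
    using End_closed[OF \<psi>E] cc by (auto simp: compose_def fun_eq_iff End_smult[OF phi_End])
  then show ?thesis
    using Cen_smult[OF c \<psi>C] by (simp add: Cen0_eq) (simp add: Cen_alg_def End_alg_def)
qed

end

context jordan_base
begin

text \<open>\<open>\<phi>\<close> acts on rows as multiplication by \<open>z\<close>, which moves the threshold for coefficients from \<open>k \<gamma>\<close>
  to \<open>k \<gamma> - 1\<close>. The constant coefficient of a multiple of \<open>z\<close> is \<open>0\<close>, which lies in \<open>J\<close>.\<close>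

lemma N0_set_iff:
  assumes P: "P \<in> carrier (mat_alg (UP R) \<Gamma>)"
  shows "P \<in> N0_set R \<Gamma> k \<longleftrightarrow> (\<forall>\<delta>\<in>\<Gamma>. \<phi> (G.comb (\<lambda>\<gamma>. P (\<delta>, \<gamma>))) = \<zero>\<^bsub>M\<^esub>)"
proof -
  have "\<phi> (G.comb (\<lambda>\<gamma>. P (\<delta>, \<gamma>))) = \<zero>\<^bsub>M\<^esub>
    \<longleftrightarrow> (\<forall>\<gamma>\<in>\<Gamma>. P (\<delta>, \<gamma>) \<in> radical_poly R <+>\<^bsub>UP R\<^esub> z_ideal R (k \<gamma> - 1))" if \<delta>: "\<delta> \<in> \<Gamma>" for \<delta>
  proof -
    note e = mat_entry[OF P \<delta>]
    have zrow: "(\<lambda>\<gamma>. z_pow R 1 \<otimes>\<^bsub>UP R\<^esub> P (\<delta>, \<gamma>)) \<in> \<Gamma> \<rightarrow> carrier (UP R)"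
      using e by (simp add: z_pow_def)
    have "\<phi> (G.comb (\<lambda>\<gamma>. P (\<delta>, \<gamma>))) = \<zero>\<^bsub>M\<^esub>
      \<longleftrightarrow> (\<forall>\<gamma>\<in>\<Gamma>. \<forall>i<k \<gamma>. coeff (UP R) (z_pow R 1 \<otimes>\<^bsub>UP R\<^esub> P (\<delta>, \<gamma>)) i \<in> J)"
      using row_times_z_pow[OF P \<delta>, of 1] comb_eq_zero[OF zrow] by simp
    also have "\<dots> \<longleftrightarrow> (\<forall>\<gamma>\<in>\<Gamma>. \<forall>i<k \<gamma> - 1. coeff (UP R) (P (\<delta>, \<gamma>)) i \<in> J)"
    proof (rule ball_cong[OF refl])
      fix \<gamma> assume \<gamma>: "\<gamma> \<in> \<Gamma>"
      have c: "coeff (UP R) (z_pow R 1 \<otimes>\<^bsub>UP R\<^esub> P (\<delta>, \<gamma>)) i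
          = (if 1 \<le> i then coeff (UP R) (P (\<delta>, \<gamma>)) (i - 1) else \<zero>)" for i
        unfolding z_pow_def UP.coeff_monom_mult[OF R.one_closed e[OF \<gamma>]] using e[OF \<gamma>] by simp
      show "(\<forall>i<k \<gamma>. coeff (UP R) (z_pow R 1 \<otimes>\<^bsub>UP R\<^esub> P (\<delta>, \<gamma>)) i \<in> J)
        \<longleftrightarrow> (\<forall>i<k \<gamma> - 1. coeff (UP R) (P (\<delta>, \<gamma>)) i \<in> J)"
      proof
        assume a: "\<forall>i<k \<gamma>. coeff (UP R) (z_pow R 1 \<otimes>\<^bsub>UP R\<^esub> P (\<delta>, \<gamma>)) i \<in> J"
        show "\<forall>i<k \<gamma> - 1. coeff (UP R) (P (\<delta>, \<gamma>)) i \<in> J"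
        proof (intro allI impI)
          fix i assume "i < k \<gamma> - 1"
          then show "coeff (UP R) (P (\<delta>, \<gamma>)) i \<in> J"
            using a[rule_format, of "Suc i"] unfolding c by simp
        qed
      next
        assume a: "\<forall>i<k \<gamma> - 1. coeff (UP R) (P (\<delta>, \<gamma>)) i \<in> J"
        then show "\<forall>i<k \<gamma>. coeff (UP R) (z_pow R 1 \<otimes>\<^bsub>UP R\<^esub> P (\<delta>, \<gamma>)) i \<in> J"
          unfolding c using J_zero by auto
      qed
    qed
    finally show ?thesis
      using e unfolding radical_plus_z_ideal[OF R.ring_axioms] by auto
  qed
  then show ?thesis using P by (simp add: N0_set_def)
qed

lemma I_set_iff:
  assumes P: "P \<in> carrier (mat_alg (UP R) \<Gamma>)"
  shows "P \<in> I_set R \<Gamma> k \<longleftrightarrow> (\<forall>\<delta>\<in>\<Gamma>. G.comb (\<lambda>\<gamma>. P (\<delta>, \<gamma>)) = \<zero>\<^bsub>M\<^esub>)"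
  using P comb_eq_zero_iff_mem[OF G.row_closed[OF P]] by (simp add: I_set_def)

text \<open>The representing matrices form \<open>N(X)\<close>, and \<open>endo\<close> is the product-reversing map from \<open>N(X)\<close> onto the
  centralizer.\<close>

definition endo :: "('i \<times> 'i \<Rightarrow> nat \<Rightarrow> 'a) \<Rightarrow> 'b \<Rightarrow> 'b" where
  "endo P = (THE \<psi>. \<psi> \<in> Cen R M \<phi> \<and> G.represents P \<psi>)"

lemma endo_eqI: "\<psi> \<in> Cen R M \<phi> \<Longrightarrow> G.represents P \<psi> \<Longrightarrow> endo P = \<psi>"
  unfolding endo_def Cen_eq_End using G.represents_unique by blast

lemma N_set_closed: "P \<in> N_set R \<Gamma> k \<Longrightarrow> P \<in> carrier (mat_alg (UP R) \<Gamma>)"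
  by (simp add: N_set_def)

lemma endo_Cen: "P \<in> N_set R \<Gamma> k \<Longrightarrow> endo P \<in> Cen R M \<phi>"
  and endo_represents: "P \<in> N_set R \<Gamma> k \<Longrightarrow> G.represents P (endo P)"
  using N_set_iff_represents[OF N_set_closed] endo_eqI by metis+

lemma N_setI:
  "P \<in> carrier (mat_alg (UP R) \<Gamma>) \<Longrightarrow> \<psi> \<in> Cen R M \<phi> \<Longrightarrow> G.represents P \<psi> \<Longrightarrow> P \<in> N_set R \<Gamma> k"
  using N_set_iff_represents by blast

lemma Cen_image: "endo ` N_set R \<Gamma> k = Cen R M \<phi>"
proof (intro equalityI subsetI)
  fix \<psi> assume \<psi>: "\<psi> \<in> Cen R M \<phi>"
  then obtain P where "P \<in> carrier (mat_alg (UP R) \<Gamma>)" "G.represents P \<psi>"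
    using G.represents_exists unfolding Cen_eq_End by blast
  then show "\<psi> \<in> endo ` N_set R \<Gamma> k" using \<psi> N_setI endo_eqI by blast
qed (use endo_Cen in auto)

lemma mat_add_closed:
  "P \<in> carrier (mat_alg (UP R) \<Gamma>) \<Longrightarrow> Q \<in> carrier (mat_alg (UP R) \<Gamma>) \<Longrightarrow>
    P \<oplus>\<^bsub>mat_alg (UP R) \<Gamma>\<^esub> Q \<in> carrier (mat_alg (UP R) \<Gamma>)"
  by (rule abelian_group.axioms(1)[OF mat_alg_abelian_group[OF UP.is_abelian_group], THEN abelian_monoid.a_closed])

lemma mat_mult_closed:
  "P \<in> carrier (mat_alg (UP R) \<Gamma>) \<Longrightarrow> Q \<in> carrier (mat_alg (UP R) \<Gamma>) \<Longrightarrow>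
    P \<otimes>\<^bsub>mat_alg (UP R) \<Gamma>\<^esub> Q \<in> carrier (mat_alg (UP R) \<Gamma>)"
  using mat_entry[of P] mat_entry[of Q] by (auto simp: mat_alg_def intro!: UP.finsum_closed)

lemma mat_smult_closed:
  "c \<in> carrier R \<Longrightarrow> P \<in> carrier (mat_alg (UP R) \<Gamma>) \<Longrightarrow>
    c \<odot>\<^bsub>mat_alg (UP R) \<Gamma>\<^esub> P \<in> carrier (mat_alg (UP R) \<Gamma>)"
  using mat_entry[of P] by (auto simp: mat_alg_def)

lemma endo_add:
  assumes P: "P \<in> N_set R \<Gamma> k" and Q: "Q \<in> N_set R \<Gamma> k"
  shows "P \<oplus>\<^bsub>mat_alg (UP R) \<Gamma>\<^esub> Q \<in> N_set R \<Gamma> k"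
    and "endo (P \<oplus>\<^bsub>mat_alg (UP R) \<Gamma>\<^esub> Q) = endo P \<oplus>\<^bsub>Cen_alg R M \<phi>\<^esub> endo Q"
proof -
  interpret C: ring "Cen_alg R M \<phi>" by (rule Cen_alg_ring)
  note m = N_set_closed[OF P] N_set_closed[OF Q]
  have C: "endo P \<oplus>\<^bsub>Cen_alg R M \<phi>\<^esub> endo Q \<in> Cen R M \<phi>"
    using C.a_closed endo_Cen P Q by (simp add: Cen_alg_simps(1))
  have rep: "G.represents (P \<oplus>\<^bsub>mat_alg (UP R) \<Gamma>\<^esub> Q) (endo P \<oplus>\<^bsub>Cen_alg R M \<phi>\<^esub> endo Q)"
    unfolding Cen_alg_simps by (rule G.represents_add[OF m endo_represents[OF P] endo_represents[OF Q]])
  show "P \<oplus>\<^bsub>mat_alg (UP R) \<Gamma>\<^esub> Q \<in> N_set R \<Gamma> k" by (rule N_setI[OF mat_add_closed[OF m] C rep])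
  show "endo (P \<oplus>\<^bsub>mat_alg (UP R) \<Gamma>\<^esub> Q) = endo P \<oplus>\<^bsub>Cen_alg R M \<phi>\<^esub> endo Q"
    by (rule endo_eqI[OF C rep])
qed

lemma endo_mult:
  assumes P: "P \<in> N_set R \<Gamma> k" and Q: "Q \<in> N_set R \<Gamma> k"
  shows "P \<otimes>\<^bsub>mat_alg (UP R) \<Gamma>\<^esub> Q \<in> N_set R \<Gamma> k"
    and "endo (P \<otimes>\<^bsub>mat_alg (UP R) \<Gamma>\<^esub> Q) = endo Q \<otimes>\<^bsub>Cen_alg R M \<phi>\<^esub> endo P"
proof -
  interpret C: ring "Cen_alg R M \<phi>" by (rule Cen_alg_ring)
  note m = N_set_closed[OF P] N_set_closed[OF Q]
  have C: "endo Q \<otimes>\<^bsub>Cen_alg R M \<phi>\<^esub> endo P \<in> Cen R M \<phi>"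
    using C.m_closed endo_Cen P Q by (simp add: Cen_alg_simps(1))
  have rep: "G.represents (P \<otimes>\<^bsub>mat_alg (UP R) \<Gamma>\<^esub> Q) (endo Q \<otimes>\<^bsub>Cen_alg R M \<phi>\<^esub> endo P)"
    unfolding Cen_alg_simps
    by (rule G.represents_mult[OF m endo_represents[OF P] endo_represents[OF Q] endo_Cen[OF Q, unfolded Cen_eq_End]])
  show "P \<otimes>\<^bsub>mat_alg (UP R) \<Gamma>\<^esub> Q \<in> N_set R \<Gamma> k" by (rule N_setI[OF mat_mult_closed[OF m] C rep])
  show "endo (P \<otimes>\<^bsub>mat_alg (UP R) \<Gamma>\<^esub> Q) = endo Q \<otimes>\<^bsub>Cen_alg R M \<phi>\<^esub> endo P"
    by (rule endo_eqI[OF C rep])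
qed

lemma endo_smult:
  assumes c: "c \<in> ring_center R" and P: "P \<in> N_set R \<Gamma> k"
  shows "c \<odot>\<^bsub>mat_alg (UP R) \<Gamma>\<^esub> P \<in> N_set R \<Gamma> k"
    and "endo (c \<odot>\<^bsub>mat_alg (UP R) \<Gamma>\<^esub> P) = c \<odot>\<^bsub>Cen_alg R M \<phi>\<^esub> endo P"
proof -
  note m = N_set_closed[OF P]
  have cc: "c \<in> carrier R" using c by (simp add: ring_center_def)
  note C = Cen_smult[OF c endo_Cen[OF P]]
  have rep: "G.represents (c \<odot>\<^bsub>mat_alg (UP R) \<Gamma>\<^esub> P) (c \<odot>\<^bsub>Cen_alg R M \<phi>\<^esub> endo P)"
    unfolding G.represents_def
  proof
    fix \<delta> assume \<delta>: "\<delta> \<in> \<Gamma>"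
    note row = G.row_closed[OF m \<delta>]
    have u: "G.comb (\<lambda>\<gamma>. P (\<delta>, \<gamma>)) \<in> carrier M" using G.comb_closed[OF row] by simp
    have "G.comb (\<lambda>\<gamma>. (c \<odot>\<^bsub>mat_alg (UP R) \<Gamma>\<^esub> P) (\<delta>, \<gamma>))
        = G.comb (\<lambda>\<gamma>. monom (UP R) c 0 \<otimes>\<^bsub>UP R\<^esub> P (\<delta>, \<gamma>))"
      by (rule G.comb_cong)
        (use cc \<delta> mat_entry[OF m \<delta>] in \<open>auto simp: UP.monom_mult_is_smult, simp add: mat_alg_def\<close>)
    also have "\<dots> = act (monom (UP R) c 0) (G.comb (\<lambda>\<gamma>. P (\<delta>, \<gamma>)))"
      by (rule G.comb_smult[OF row]) (use cc in simp)
    also have "\<dots> = c \<odot>\<^bsub>M\<^esub> G.comb (\<lambda>\<gamma>. P (\<delta>, \<gamma>))" using act_monom[OF cc u, of 0] by simp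
    finally show "(c \<odot>\<^bsub>Cen_alg R M \<phi>\<^esub> endo P) (x \<delta> (Suc 0))
        = G.comb (\<lambda>\<gamma>. (c \<odot>\<^bsub>mat_alg (UP R) \<Gamma>\<^esub> P) (\<delta>, \<gamma>))"
      using endo_represents[OF P] \<delta> x1_closed[OF \<delta>] by (simp add: Cen_alg_simps G.represents_def)
  qed
  show "c \<odot>\<^bsub>mat_alg (UP R) \<Gamma>\<^esub> P \<in> N_set R \<Gamma> k" by (rule N_setI[OF mat_smult_closed[OF cc m] C rep])
  show "endo (c \<odot>\<^bsub>mat_alg (UP R) \<Gamma>\<^esub> P) = c \<odot>\<^bsub>Cen_alg R M \<phi>\<^esub> endo P"
    by (rule endo_eqI[OF C rep])
qed

text \<open>This determines the kernel of \<open>endo\<close> and, applied to \<open>\<phi> \<psi>\<close> in place of \<open>\<psi>\<close>, the preimage of the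
  zero-level centralizer.\<close>

lemma Cen_eq_zero_iff:
  assumes "\<psi> \<in> Cen R M \<phi>"
  shows "\<psi> = \<zero>\<^bsub>Cen_alg R M \<phi>\<^esub> \<longleftrightarrow> (\<forall>\<delta>\<in>\<Gamma>. \<psi> (x \<delta> (Suc 0)) = \<zero>\<^bsub>M\<^esub>)"
proof
  interpret C: ring "Cen_alg R M \<phi>" by (rule Cen_alg_ring)
  assume "\<forall>\<delta>\<in>\<Gamma>. \<psi> (x \<delta> (Suc 0)) = \<zero>\<^bsub>M\<^esub>"
  then show "\<psi> = \<zero>\<^bsub>Cen_alg R M \<phi>\<^esub>"
    using assms C.zero_closed x1_closed
    by (intro G.End_eq_on_generators) (auto simp: Cen_alg_simps(1,2) Cen_eq_End[symmetric])
qed (use x1_closed in \<open>auto simp: Cen_alg_simps\<close>)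

lemma endo_eq_zero_iff:
  assumes "P \<in> N_set R \<Gamma> k"
  shows "endo P = \<zero>\<^bsub>Cen_alg R M \<phi>\<^esub> \<longleftrightarrow> P \<in> I_set R \<Gamma> k"
  unfolding Cen_eq_zero_iff[OF endo_Cen[OF assms]] I_set_iff[OF N_set_closed[OF assms]]
  using endo_represents[OF assms] by (simp add: G.represents_def)

lemma endo_mem_Cen0_iff:
  assumes "P \<in> N_set R \<Gamma> k"
  shows "endo P \<in> Cen0 R M \<phi> \<longleftrightarrow> P \<in> N0_set R \<Gamma> k"
proof -
  interpret C: ring "Cen_alg R M \<phi>" by (rule Cen_alg_ring)
  note e = endo_Cen[OF assms]
  have "\<phi> \<otimes>\<^bsub>Cen_alg R M \<phi>\<^esub> endo P \<in> Cen R M \<phi>"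
    using C.m_closed phi_mem_Cen e by (simp add: Cen_alg_simps(1))
  from Cen_eq_zero_iff[OF this] show ?thesis
    unfolding N0_set_iff[OF N_set_closed[OF assms]] Cen0_eq
    using e endo_represents[OF assms] x1_closed
    by (simp add: G.represents_def Cen_alg_def End_alg_def compose_def)
qed

lemma I_subset_N0: "I_set R \<Gamma> k \<subseteq> N0_set R \<Gamma> k"
proof
  fix P assume P: "P \<in> I_set R \<Gamma> k"
  then have m: "P \<in> carrier (mat_alg (UP R) \<Gamma>)" by (simp add: I_set_def)
  show "P \<in> N0_set R \<Gamma> k"
    using P End_zero[OF phi_End] unfolding N0_set_iff[OF m] I_set_iff[OF m] by simp
qed

text \<open>Multiplication by \<open>z\<^sup>n\<close> with \<open>n = k \<delta> \<ge> 1\<close> raises the threshold \<open>k \<gamma> - 1\<close> for coefficients to at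
  least \<open>k \<gamma>\<close>.\<close>

lemma N0_subset_N: "N0_set R \<Gamma> k \<subseteq> N_set R \<Gamma> k"
proof
  fix P assume P: "P \<in> N0_set R \<Gamma> k"
  then have m: "P \<in> carrier (mat_alg (UP R) \<Gamma>)" by (simp add: N0_set_def)
  have c: "coeff (UP R) (P (\<delta>, \<gamma>)) i \<in> J" if "\<delta> \<in> \<Gamma>" "\<gamma> \<in> \<Gamma>" "i < k \<gamma> - 1" for \<delta> \<gamma> i
    using P that unfolding N0_set_def radical_plus_z_ideal[OF R.ring_axioms] by blast
  have "z_pow R (k \<delta>) \<otimes>\<^bsub>UP R\<^esub> P (\<delta>, \<gamma>) \<in> radical_poly R <+>\<^bsub>UP R\<^esub> z_ideal R (k \<gamma>)"
    if d: "\<delta> \<in> \<Gamma>" "\<gamma> \<in> \<Gamma>" for \<delta> \<gamma>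
    unfolding radical_plus_z_ideal[OF R.ring_axioms]
    using mat_entry[OF m d] c[OF d] k_pos[OF d(1)] J_zero
    by (auto simp: z_pow_def UP.coeff_monom_mult simp del: UP.coeff_mult)
  then show "P \<in> N_set R \<Gamma> k" using m by (simp add: N_set_def)
qed

text \<open>The scalar \<open>-1\<close> is central, so sets of matrices that are closed under central scalars are closed
  under negatives.\<close>

lemma restrict_mat_abelian_group:
  assumes sub: "H \<subseteq> carrier (mat_alg (UP R) \<Gamma>)" and I: "I_set R \<Gamma> k \<subseteq> H"
    and add: "\<And>P Q. P \<in> H \<Longrightarrow> Q \<in> H \<Longrightarrow> P \<oplus>\<^bsub>mat_alg (UP R) \<Gamma>\<^esub> Q \<in> H"
    and sm: "\<And>c P. c \<in> ring_center R \<Longrightarrow> P \<in> H \<Longrightarrow> c \<odot>\<^bsub>mat_alg (UP R) \<Gamma>\<^esub> P \<in> H"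
  shows "abelian_group ((mat_alg (UP R) \<Gamma>)\<lparr>carrier := H\<rparr>)"
proof (rule abelian_group.abelian_group_restrict[OF mat_alg_abelian_group[OF UP.is_abelian_group] sub])
  interpret A: abelian_group "mat_alg (UP R) \<Gamma>" by (rule mat_alg_abelian_group[OF UP.is_abelian_group])
  have "G.comb (\<lambda>\<gamma>. \<zero>\<^bsub>mat_alg (UP R) \<Gamma>\<^esub> (\<delta>, \<gamma>)) = \<zero>\<^bsub>M\<^esub>" if "\<delta> \<in> \<Gamma>" for \<delta>
    by (subst comb_eq_zero) (use that J_zero in \<open>auto simp: mat_alg_def\<close>)
  then show "\<zero>\<^bsub>mat_alg (UP R) \<Gamma>\<^esub> \<in> H"
    using I I_set_iff[OF A.zero_closed] by blast
  fix P assume P: "P \<in> H"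
  have m: "\<ominus> \<one> \<in> ring_center R" by (simp add: ring_center_def R.l_minus R.r_minus)
  have "((\<ominus> \<one>) \<odot>\<^bsub>UP R\<^esub> p) \<oplus>\<^bsub>UP R\<^esub> p = \<zero>\<^bsub>UP R\<^esub>" if "p \<in> carrier (UP R)" for p
    by (rule UP.up_eqI) (use that in \<open>auto simp: R.l_minus R.l_neg\<close>)
  then have "((\<ominus> \<one>) \<odot>\<^bsub>mat_alg (UP R) \<Gamma>\<^esub> P) \<oplus>\<^bsub>mat_alg (UP R) \<Gamma>\<^esub> P = \<zero>\<^bsub>mat_alg (UP R) \<Gamma>\<^esub>"
    using mat_entry[of P] P sub by (auto simp: mat_alg_def fun_eq_iff)
  then show "\<exists>Q\<in>H. Q \<oplus>\<^bsub>mat_alg (UP R) \<Gamma>\<^esub> P = \<zero>\<^bsub>mat_alg (UP R) \<Gamma>\<^esub>"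
    using sm[OF m P] by blast
qed (use add in auto)

lemma N_abelian_group: "abelian_group (N_alg R \<Gamma> k)"
  unfolding N_alg_def
  by (rule restrict_mat_abelian_group)
    (use N_set_closed I_subset_N0 N0_subset_N endo_add(1) endo_smult(1) in auto)

lemma N0_eq: "N0_set R \<Gamma> k = {P \<in> N_set R \<Gamma> k. endo P \<in> Cen0 R M \<phi>}"
  using N0_subset_N endo_mem_Cen0_iff by auto

lemma N0_closed:
  "P \<in> N0_set R \<Gamma> k \<Longrightarrow> Q \<in> N0_set R \<Gamma> k \<Longrightarrow> P \<oplus>\<^bsub>mat_alg (UP R) \<Gamma>\<^esub> Q \<in> N0_set R \<Gamma> k"
  "P \<in> N0_set R \<Gamma> k \<Longrightarrow> Q \<in> N0_set R \<Gamma> k \<Longrightarrow> P \<otimes>\<^bsub>mat_alg (UP R) \<Gamma>\<^esub> Q \<in> N0_set R \<Gamma> k"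
  "c \<in> ring_center R \<Longrightarrow> P \<in> N0_set R \<Gamma> k \<Longrightarrow> c \<odot>\<^bsub>mat_alg (UP R) \<Gamma>\<^esub> P \<in> N0_set R \<Gamma> k"
proof -
  interpret I: ideal "Cen0 R M \<phi>" "Cen_alg R M \<phi>" by (rule Cen0_ideal)
  show "P \<in> N0_set R \<Gamma> k \<Longrightarrow> Q \<in> N0_set R \<Gamma> k \<Longrightarrow> P \<oplus>\<^bsub>mat_alg (UP R) \<Gamma>\<^esub> Q \<in> N0_set R \<Gamma> k"
    and "P \<in> N0_set R \<Gamma> k \<Longrightarrow> Q \<in> N0_set R \<Gamma> k \<Longrightarrow> P \<otimes>\<^bsub>mat_alg (UP R) \<Gamma>\<^esub> Q \<in> N0_set R \<Gamma> k"
    and "c \<in> ring_center R \<Longrightarrow> P \<in> N0_set R \<Gamma> k \<Longrightarrow> c \<odot>\<^bsub>mat_alg (UP R) \<Gamma>\<^esub> P \<in> N0_set R \<Gamma> k"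
    unfolding N0_eq
    using endo_add endo_mult endo_smult Cen0_smult
    by (auto simp: I.I_l_closed Cen_alg_simps(1) endo_Cen)
qed

lemma N0_abelian_group: "abelian_group (N0_alg R \<Gamma> k)"
  unfolding N0_alg_def
  by (rule restrict_mat_abelian_group)
    (use N_set_closed I_subset_N0 N0_subset_N N0_closed(1,3) in auto)

lemma Cen0_abelian_group: "abelian_group (Cen0_alg R M \<phi>)"
proof -
  interpret I: ideal "Cen0 R M \<phi>" "Cen_alg R M \<phi>" by (rule Cen0_ideal)
  have "abelian_group ((Cen_alg R M \<phi>)\<lparr>carrier := Cen0 R M \<phi>\<rparr>)"
    by (rule I.abelian_group_restrict)
      (use I.l_neg in \<open>auto intro!: I.a_subset bexI[of _ "\<ominus>\<^bsub>Cen_alg R M \<phi>\<^esub> _"]\<close>)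
  then show ?thesis by (simp add: Cen_alg_def Cen0_alg_def)
qed

lemma Cen0_isomorphic:
  "alg_isomorphic (ring_center R) (Cen0_alg R M \<phi>)
     (opp_alg (quot_alg (N0_alg R \<Gamma> k) (I_set R \<Gamma> k)))"
proof (rule alg_isomorphic_opp_quot[OF N0_abelian_group Cen0_abelian_group, where h = endo])
  have ops: "add (Cen0_alg R M \<phi>) = add (Cen_alg R M \<phi>)" "mult (Cen0_alg R M \<phi>) = mult (Cen_alg R M \<phi>)"
    "zero (Cen0_alg R M \<phi>) = zero (Cen_alg R M \<phi>)" "smult (Cen0_alg R M \<phi>) = smult (Cen_alg R M \<phi>)"
    "carrier (Cen0_alg R M \<phi>) = Cen0 R M \<phi>"
    by (simp_all add: Cen0_alg_def Cen_alg_def)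
  note simps = ops N0_alg_def N0_closed
  show "endo ` carrier (N0_alg R \<Gamma> k) = carrier (Cen0_alg R M \<phi>)"
    using Cen_image by (auto simp: simps N0_eq Cen0_eq)
  show "I_set R \<Gamma> k = {P \<in> carrier (N0_alg R \<Gamma> k). endo P = \<zero>\<^bsub>Cen0_alg R M \<phi>\<^esub>}"
    using I_subset_N0 N0_subset_N endo_eq_zero_iff by (auto simp: simps)
qed (use endo_add endo_mult endo_smult N0_closed in
    \<open>auto simp: N0_alg_def Cen0_alg_def Cen_alg_def subsetD[OF N0_subset_N]\<close>)

lemma Cen_quotient_isomorphic:
  "alg_isomorphic (ring_center R) (quot_alg (Cen_alg R M \<phi>) (Cen0 R M \<phi>))
     (opp_alg (quot_alg (N_alg R \<Gamma> k) (N0_set R \<Gamma> k)))"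
proof -
  let ?C = "Cen_alg R M \<phi>" and ?Z = "Cen0 R M \<phi>"
  let ?p = "\<lambda>\<psi>. ?Z +>\<^bsub>?C\<^esub> \<psi>"
  interpret I: ideal ?Z ?C by (rule Cen0_ideal)
  have sm_add: "c \<odot>\<^bsub>?C\<^esub> (\<psi> \<oplus>\<^bsub>?C\<^esub> \<chi>) = c \<odot>\<^bsub>?C\<^esub> \<psi> \<oplus>\<^bsub>?C\<^esub> c \<odot>\<^bsub>?C\<^esub> \<chi>"
    if "c \<in> ring_center R" "\<psi> \<in> carrier ?C" "\<chi> \<in> carrier ?C" for c \<psi> \<chi>
    using that by (auto simp: Cen_alg_simps(1,5) ring_center_def)
      (auto simp: Cen_alg_def End_alg_def Cen_def fun_eq_iff smult_r_distr PiE_iff)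
  have sm: "c \<odot>\<^bsub>?C\<^esub> \<psi> \<in> carrier ?C" if "c \<in> ring_center R" "\<psi> \<in> carrier ?C" for c \<psi>
    using Cen_smult that by (simp add: Cen_alg_simps(1))
  note pr = quot_alg_projection[OF Cen0_ideal sm sm_add Cen0_smult, of "ring_center R"]
  have hom: "?p (\<psi> \<oplus>\<^bsub>?C\<^esub> \<chi>) = ?p \<psi> \<oplus>\<^bsub>quot_alg ?C ?Z\<^esub> ?p \<chi>"
      "?p (\<psi> \<otimes>\<^bsub>?C\<^esub> \<chi>) = ?p \<psi> \<otimes>\<^bsub>quot_alg ?C ?Z\<^esub> ?p \<chi>"
    if "\<psi> \<in> Cen R M \<phi>" "\<chi> \<in> Cen R M \<phi>" for \<psi> \<chi>
    using pr(2) that by (auto simp: alg_hom_def Cen_alg_simps(1))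
  have hom_sm: "?p (c \<odot>\<^bsub>?C\<^esub> \<psi>) = c \<odot>\<^bsub>quot_alg ?C ?Z\<^esub> ?p \<psi>"
    if "c \<in> ring_center R" "\<psi> \<in> Cen R M \<phi>" for c \<psi>
    using pr(2) that by (auto simp: alg_hom_def Cen_alg_simps(1))
  show ?thesis
  proof (rule alg_isomorphic_opp_quot[OF N_abelian_group, where h = "\<lambda>P. ?p (endo P)"])
    show "abelian_group (quot_alg ?C ?Z)" using pr(1) by blast
    have "(\<lambda>P. ?p (endo P)) ` carrier (N_alg R \<Gamma> k) = ?p ` (endo ` N_set R \<Gamma> k)"
      by (simp add: N_alg_def image_image)
    also have "\<dots> = ?p ` carrier ?C" by (simp only: Cen_image Cen_alg_simps(1))
    also have "\<dots> = carrier (quot_alg ?C ?Z)" using pr(3) by blast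
    finally show "(\<lambda>P. ?p (endo P)) ` carrier (N_alg R \<Gamma> k) = carrier (quot_alg ?C ?Z)" .
    show "N0_set R \<Gamma> k = {P \<in> carrier (N_alg R \<Gamma> k). ?p (endo P) = \<zero>\<^bsub>quot_alg ?C ?Z\<^esub>}"
      unfolding N0_eq using pr(4) endo_Cen by (auto simp: N_alg_def Cen_alg_simps(1))
  qed (use endo_add endo_mult endo_smult endo_Cen hom hom_sm in \<open>auto simp: N_alg_def\<close>)
qed

end

theorem theorem3p4:
  fixes R :: "('a, 'c) ring_scheme"
    and M :: "('a, 'b, 'd) module_scheme"
    and \<phi> :: "'b \<Rightarrow> 'b"
    and m :: nat and k :: "nat \<Rightarrow> nat" and x :: "nat \<Rightarrow> nat \<Rightarrow> 'b"
  assumes "local_ring R"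
    and "left_module R M" and "fin_gen_module R M" and "semisimple_module R M"
    and "\<phi> \<in> carrier (End_alg R M)" and "nilpotent_End R M \<phi>"
    and "nilpotent_Jordan_base R M \<phi> {1..m} k x"
    and "\<forall>\<gamma>\<in>{1..<m}. k (\<gamma> + 1) \<le> k \<gamma>"
    and "\<forall>\<gamma>\<in>{1..m}. 1 \<le> k \<gamma>"
  shows "alg_isomorphic (ring_center R)
           (Cen0_alg R M \<phi>)
           (opp_alg (quot_alg (N0_alg R {1..m} k) (I_set R {1..m} k))) \<and>
         opp_alg (quot_alg (N0_alg R {1..m} k) (I_set R {1..m} k)) =
           quot_alg (opp_alg (N0_alg R {1..m} k)) (I_set R {1..m} k) \<and>
         alg_isomorphic (ring_center R)
           (quot_alg (Cen_alg R M \<phi>) (Cen0 R M \<phi>))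
           (opp_alg (quot_alg (N_alg R {1..m} k) (N0_set R {1..m} k))) \<and>
         opp_alg (quot_alg (N_alg R {1..m} k) (N0_set R {1..m} k)) =
           quot_alg (opp_alg (N_alg R {1..m} k)) (N0_set R {1..m} k)"
proof -
  interpret jordan_base R M \<phi> "{1..m}" k x
    using assms
    by (intro jordan_base.intro module_endomorphism.intro module_endomorphism_axioms.intro
        jordan_base_axioms.intro) auto
  show ?thesis
    using Cen0_isomorphic Cen_quotient_isomorphic opp_quot_alg by blast
qed

end
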